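(* Consider the polynomial regression model $y(x)=\theta^Tf(x)+\varepsilon(x)$ with $f(x)=(1,x,x^2,\dots,x^{m-1})^T$, $x\in[-1,1]$, and the covariance kernel $$K(u,v)=\gamma-\beta\ln(u-v)^2,\qquad \beta>0,\ \gamma\ge0.$$ Then the arcsine design $\xi_a$, with density $p(x)=1/(\pi\sqrt{1-x^2})$, $x\in(-1,1)$, is the universally optimal design, i.e. $\xi_a\in\Xi$ and $D(\xi_a)\le D(\xi)$ in the Loewner ordering for every $\xi\in\Xi$.
   Context: A design is a (Borel) probability measure $\xi$ on $\mathcal X=[-1,1]$. On the diagonal $K(u,u)=+\infty$. Set $$M(\xi)=\int f(u)f^T(u)\,\xi(du),\quad B(\xi,\xi)=\iint K(u,v)f(u)f^T(v)\,\xi(du)\,\xi(dv),$$ $$D(\xi)=M^{-1}(\xi)B(\xi,\xi)M^{-1}(\xi).$$ $\Xi$ is the set of designs $\xi$ for which $B(\xi,\xi)$ is well defined (the integrals exist and are finite) and $M(\xi)$ is invertible. A design $\xi^*\in\Xi$ is universally optimal if $D(\xi^* )\le D(\xi)$ in the Loewner ordering for every $\xi\in\Xi$. *)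

theory Defs
  imports "HOL-Probability.Probability" "Jordan_Normal_Form.Gauss_Jordan_Elimination"
begin

(* The names vec and mat refer to the matrices of Jordan_Normal_Form, whose dimensions are
   natural numbers; they are qualified because HOL-Analysis uses some of the same names.
   Indices start at 0. *)

definition design :: "real measure \<Rightarrow> bool" where
  "design \<xi> \<longleftrightarrow> prob_space \<xi> \<and> sets \<xi> = sets (restrict_space borel {-1..1})"

text \<open>Lebesgue integrals of functions with values in the extended reals. The integral exists and
  is finite iff the positive and the negative part both have finite integral. Note that
  \<open>e2ennreal\<close> maps negative numbers to 0.\<close>

definition ereal_integrable :: "'a measure \<Rightarrow> ('a \<Rightarrow> ereal) \<Rightarrow> bool" where
  "ereal_integrable M g \<longleftrightarrow> g \<in> borel_measurable M \<and>
     (\<integral>\<^sup>+ x. e2ennreal (g x) \<partial>M) < \<infinity> \<and> (\<integral>\<^sup>+ x. e2ennreal (- g x) \<partial>M) < \<infinity>"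

definition ereal_integral :: "'a measure \<Rightarrow> ('a \<Rightarrow> ereal) \<Rightarrow> real" where
  "ereal_integral M g =
     enn2real (\<integral>\<^sup>+ x. e2ennreal (g x) \<partial>M) - enn2real (\<integral>\<^sup>+ x. e2ennreal (- g x) \<partial>M)"

text \<open>In what follows \<open>f\<close> is the vector of the \<open>m\<close> regression functions, assumed to be continuous
  (so that all integrals in the information matrix exist), and \<open>K\<close> is the covariance kernel,
  which may take the value \<open>\<infinity>\<close>.\<close>

definition info_mat :: "nat \<Rightarrow> (real \<Rightarrow> real Matrix.vec) \<Rightarrow> real measure \<Rightarrow> real Matrix.mat" where
  "info_mat m f \<xi> =
     Matrix.mat m m (\<lambda>(i, j). \<integral>u. vec_index (f u) i * vec_index (f u) j \<partial>\<xi>)"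

text \<open>In the extended reals \<open>\<infinity> * 0 = 0\<close>.\<close>

definition B_integrand ::
  "(real \<Rightarrow> real Matrix.vec) \<Rightarrow> (real \<Rightarrow> real \<Rightarrow> ereal) \<Rightarrow> nat \<Rightarrow> nat \<Rightarrow> real \<times> real \<Rightarrow> ereal" where
  "B_integrand f K i j = (\<lambda>(u, v). K u v * ereal (vec_index (f u) i * vec_index (f v) j))"

definition B_well_defined ::
  "nat \<Rightarrow> (real \<Rightarrow> real Matrix.vec) \<Rightarrow> (real \<Rightarrow> real \<Rightarrow> ereal) \<Rightarrow> real measure \<Rightarrow> bool" where
  "B_well_defined m f K \<xi> \<longleftrightarrow>
     (\<forall>i<m. \<forall>j<m. ereal_integrable (\<xi> \<Otimes>\<^sub>M \<xi>) (B_integrand f K i j))"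

definition B_mat ::
  "nat \<Rightarrow> (real \<Rightarrow> real Matrix.vec) \<Rightarrow> (real \<Rightarrow> real \<Rightarrow> ereal) \<Rightarrow> real measure \<Rightarrow> real Matrix.mat" where
  "B_mat m f K \<xi> =
     Matrix.mat m m (\<lambda>(i, j). ereal_integral (\<xi> \<Otimes>\<^sub>M \<xi>) (B_integrand f K i j))"

definition D_mat ::
  "nat \<Rightarrow> (real \<Rightarrow> real Matrix.vec) \<Rightarrow> (real \<Rightarrow> real \<Rightarrow> ereal) \<Rightarrow> real measure \<Rightarrow> real Matrix.mat" where
  "D_mat m f K \<xi> =
     the (mat_inverse (info_mat m f \<xi>)) * B_mat m f K \<xi> * the (mat_inverse (info_mat m f \<xi>))"

definition admissible_designs ::
  "nat \<Rightarrow> (real \<Rightarrow> real Matrix.vec) \<Rightarrow> (real \<Rightarrow> real \<Rightarrow> ereal) \<Rightarrow> real measure set" where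
  "admissible_designs m f K =
     {\<xi>. design \<xi> \<and> B_well_defined m f K \<xi> \<and> invertible_mat (info_mat m f \<xi>)}"

definition psd_mat :: "nat \<Rightarrow> real Matrix.mat \<Rightarrow> bool" where
  "psd_mat m A \<longleftrightarrow> A \<in> carrier_mat m m \<and> transpose_mat A = A \<and>
     (\<forall>v \<in> carrier_vec m. 0 \<le> scalar_prod v (mult_mat_vec A v))"

definition loewner_le :: "nat \<Rightarrow> real Matrix.mat \<Rightarrow> real Matrix.mat \<Rightarrow> bool" where
  "loewner_le m A B \<longleftrightarrow> A \<in> carrier_mat m m \<and> B \<in> carrier_mat m m \<and> psd_mat m (B - A)"

definition universally_optimal ::
  "nat \<Rightarrow> (real \<Rightarrow> real Matrix.vec) \<Rightarrow> (real \<Rightarrow> real \<Rightarrow> ereal) \<Rightarrow> real measure \<Rightarrow> bool" where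
  "universally_optimal m f K \<xi> \<longleftrightarrow> \<xi> \<in> admissible_designs m f K \<and>
     (\<forall>\<eta> \<in> admissible_designs m f K. loewner_le m (D_mat m f K \<xi>) (D_mat m f K \<eta>))"

definition poly_regressors :: "nat \<Rightarrow> real \<Rightarrow> real Matrix.vec" where
  "poly_regressors m x = Matrix.vec m (\<lambda>i. x ^ i)"

text \<open>The value on the diagonal has to be given explicitly since \<open>ln 0 = 0\<close> in HOL.\<close>

definition log_kernel :: "real \<Rightarrow> real \<Rightarrow> real \<Rightarrow> real \<Rightarrow> ereal" where
  "log_kernel \<gamma> \<beta> u v = (if u = v then \<infinity> else ereal (\<gamma> - \<beta> * ln ((u - v)\<^sup>2)))"

definition arcsine_design :: "real measure" where
  "arcsine_design = density (restrict_space lborel {-1..1})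
     (\<lambda>x. indicator {-1<..<1} x * ennreal (1 / (pi * sqrt (1 - x\<^sup>2))))"

end

theory Submission
  imports Defs "Jordan_Normal_Form.Determinant"
begin

text \<open>For a design \<open>\<xi>\<close>, a vector \<open>c\<close> and the polynomial \<open>g = (M\<inverse> c)\<^sup>T f\<close>, the number \<open>c\<^sup>T D(\<xi>) c\<close> is the
  energy \<open>\<integral>\<integral> K(u,v) g(u) g(v)\<close>, and the moments \<open>\<integral> x\<^sup>j g d\<xi> = c\<^sub>j\<close> for \<open>j < m\<close> do not depend on
  \<open>\<xi>\<close>. The expansion \<open>- ln (4 (u - v)\<^sup>2) = \<Sum> (4/n) T\<^sub>n(u) T\<^sub>n(v)\<close> over \<open>n \<ge> 1\<close> into Chebyshev polynomials
  writes the energy as a sum of nonnegative multiples of the squares \<open>(\<integral> T\<^sub>n g d\<xi>)\<^sup>2\<close> (up to the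
  contribution of \<open>n = 0\<close>). The terms with \<open>n < m\<close> are determined by \<open>c\<close>; for the arcsine design the
  others vanish, because the \<open>T\<^sub>n\<close> are orthogonal with respect to it. To make sense of the series on
  the diagonal, it is damped by \<open>r\<^sup>n\<close> and \<open>r\<close> is sent to 1 with dominated convergence.\<close>

subsection \<open>Chebyshev polynomials and the damped logarithmic kernel\<close>

text \<open>Twice the real part of the Taylor series of \<open>- Ln (1 - z)\<close> at z = r e^(it):
  the square of the modulus of 1 - z is \<open>1 - 2 * r * cos t + r\<^sup>2\<close>.\<close>

lemma cos_series_ln:
  fixes r t :: real
  assumes "0 \<le> r" "r < 1"
  shows "(\<lambda>n. 2 * r ^ Suc n / real (Suc n) * cos (real (Suc n) * t)) sums - ln (1 - 2 * r * cos t + r\<^sup>2)"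
proof -
  define z where "z = of_real r * cis t"
  have nz: "norm z < 1" using assms by (simp add: z_def norm_mult)
  have zn: "z ^ n = of_real (r ^ n) * cis (real n * t)" for n
    by (simp only: z_def power_mult_distrib Complex.DeMoivre of_real_power)
  have "(\<lambda>n. - (z ^ n / of_nat n)) sums Ln (1 - z)"
    using Ln_series'[of "- z"] nz by simp
  from sums_Re[OF this] have "(\<lambda>n. - (r ^ n / real n * cos (real n * t))) sums Re (Ln (1 - z))"
    by (simp add: zn)
  from sums_mult[OF this, of "-2"]
  have *: "(\<lambda>n. 2 * r ^ n / real n * cos (real n * t)) sums (- 2 * Re (Ln (1 - z)))"
    by (simp add: mult_ac)
  have nz1: "1 - z \<noteq> 0" using nz by auto
  have "(cmod (1 - z))\<^sup>2 = (1 - r * cos t)\<^sup>2 + (r * sin t)\<^sup>2"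
    by (simp add: cmod_power2 z_def)
  also have "\<dots> = 1 - 2 * r * cos t + r\<^sup>2 * ((sin t)\<^sup>2 + (cos t)\<^sup>2)"
  proof -
    have "(1 - r * c)\<^sup>2 + (r * s)\<^sup>2 = 1 - 2 * r * c + r\<^sup>2 * (s\<^sup>2 + c\<^sup>2)" for s c :: real
      by (simp add: power2_eq_square algebra_simps)
    then show ?thesis .
  qed
  finally have c: "(cmod (1 - z))\<^sup>2 = 1 - 2 * r * cos t + r\<^sup>2" by simp
  have "2 * Re (Ln (1 - z)) = ln (1 - 2 * r * cos t + r\<^sup>2)"
    using nz1 ln_realpow[of "cmod (1 - z)" 2] by (simp add: c)
  with * have "(\<lambda>n. 2 * r ^ n / real n * cos (real n * t)) sums - ln (1 - 2 * r * cos t + r\<^sup>2)"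
    by simp
  \<comment> \<open>The term at n = 0 is a division by 0, hence 0 in HOL, so shifting the index
    leaves the sum unchanged.\<close>
  then show ?thesis
    by (subst sums_Suc_iff[where f = "\<lambda>n. 2 * r ^ n / real n * cos (real n * t)"]) simp
qed

text \<open>Chebyshev polynomials of the first kind. The recursion, unlike cos (n arccos x), gives
  polynomials on the whole line and lets measurability, continuity and the coefficients be obtained
  by induction.\<close>

fun cheb :: "nat \<Rightarrow> real \<Rightarrow> real" where
  "cheb 0 x = 1"
| "cheb (Suc 0) x = x"
| "cheb (Suc (Suc n)) x = 2 * x * cheb (Suc n) x - cheb n x"

text \<open>The recursion is the identity cos (s + t) + cos (s - t) = 2 cos s cos t at s = (n + 1)
  t.\<close>

lemma cheb_cos: "cheb n (cos t) = cos (real n * t)"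
proof (induction n rule: induct_nat_012)
  case (ge2 n)
  then show ?case
    using cos_add[of "real (Suc n) * t" t] cos_diff[of "real (Suc n) * t" t]
    by (simp add: algebra_simps)
qed simp_all

lemma cheb_arccos: "x \<in> {-1..1} \<Longrightarrow> cheb n x = cos (real n * arccos x)"
  using cheb_cos[of n "arccos x"] by simp

lemma abs_cheb_le_1: "x \<in> {-1..1} \<Longrightarrow> \<bar>cheb n x\<bar> \<le> 1"
  by (simp add: cheb_arccos)

lemma measurable_cheb [measurable]: "cheb n \<in> borel_measurable borel"
proof (induction n rule: induct_nat_012)
  case (ge2 n)
  note [measurable] = ge2
  show ?case unfolding cheb.simps by measurable
qed simp_all

lemma continuous_on_cheb: "continuous_on S (cheb n)"
proof (induction n rule: induct_nat_012)
  case (ge2 n)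
  then show ?case unfolding cheb.simps by (intro continuous_intros)
qed simp_all

lemma isCont_cheb: "isCont (cheb n) x"
  using continuous_on_cheb[of UNIV n] by (simp add: continuous_on_eq_continuous_at)

text \<open>The degree bound n matters: for n < m it makes the n-th Chebyshev moment a combination
  of power moments of order below m.\<close>

lemma cheb_poly_expansion:
  "\<exists>a. \<forall>x. cheb n x = (\<Sum>j\<le>n. a j * x ^ j)"
proof (induction n rule: induct_nat_012)
  case 0
  show ?case by (intro exI[of _ "\<lambda>_. 1"]) simp
next
  case 1
  show ?case by (intro exI[of _ "\<lambda>j. real j"]) simp
next
  case (ge2 n)
  then obtain a b where a: "\<forall>x. cheb n x = (\<Sum>j\<le>n. a j * x ^ j)"
    and b: "\<forall>x. cheb (Suc n) x = (\<Sum>j\<le>Suc n. b j * x ^ j)" by auto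
  \<comment> \<open>Coefficients of \<open>2 * x * cheb (Suc n) x - cheb n x\<close>: those of the
    first polynomial shifted by one and doubled, minus those of the second padded with
    zeros.\<close>
  define c where "c j = (if j = 0 then 0 else 2 * b (j - 1)) - (if j \<le> n then a j else 0)" for j
  have "cheb (Suc (Suc n)) x = (\<Sum>j\<le>Suc (Suc n). c j * x ^ j)" for x
  proof -
    have "(\<Sum>j\<le>Suc (Suc n). c j * x ^ j) =
        (\<Sum>j\<le>Suc (Suc n). (if j = 0 then 0 else 2 * b (j - 1)) * x ^ j) -
        (\<Sum>j\<le>Suc (Suc n). (if j \<le> n then a j else 0) * x ^ j)"
      by (simp only: c_def left_diff_distrib sum_subtractf)
    also have "(\<Sum>j\<le>Suc (Suc n). (if j = 0 then 0 else 2 * b (j - 1)) * x ^ j) =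
        2 * x * (\<Sum>j\<le>Suc n. b j * x ^ j)"
      by (simp only: sum.atMost_Suc_shift[of _ "Suc n"] sum_distrib_left) (simp add: mult_ac)
    also have "(\<Sum>j\<le>Suc (Suc n). (if j \<le> n then a j else 0) * x ^ j) = (\<Sum>j\<le>n. a j * x ^ j)"
      by (simp add: atMost_Suc)
    finally show ?thesis using a b by simp
  qed
  then show ?case by blast
qed

lemma abs_ln_le:
  fixes a x b :: real
  assumes "0 < a" "a \<le> x" "x \<le> b"
  shows "\<bar>ln x\<bar> \<le> \<bar>ln a\<bar> + \<bar>ln b\<bar>"
proof -
  have "0 < x" "0 < b" using assms by linarith+
  then have "ln a \<le> ln x" "ln x \<le> ln b"
    using assms by (auto intro: ln_le_cancel_iff[THEN iffD2])
  then show ?thesis by linarith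
qed

text \<open>For \<open>u = cos a\<close> and \<open>v = cos b\<close> this is \<open>\<bar>1 - r e\<^bsup>i(a+b)\<^esup>\<bar>\<^sup>2 \<bar>1 - r e\<^bsup>i(a-b)\<^esup>\<bar>\<^sup>2\<close>, whose logarithm
  has a power series in \<open>r\<close>.\<close>

definition pkernel :: "real \<Rightarrow> real \<Rightarrow> real \<Rightarrow> real" where
  "pkernel r u v = (1 + r\<^sup>2)\<^sup>2 - 4 * r * (1 + r\<^sup>2) * u * v + 4 * r\<^sup>2 * (u\<^sup>2 + v\<^sup>2 - 1)"

lemma measurable_pkernel [measurable]:
  assumes [measurable]: "X \<in> borel_measurable M" "Y \<in> borel_measurable M"
  shows "(\<lambda>z. pkernel r (X z) (Y z)) \<in> borel_measurable M"
  unfolding pkernel_def by measurable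

text \<open>Expanding the right side leaves only the sum and the product of cos (a + b) and cos (a -
  b), and both are polynomials in cos a and cos b.\<close>

lemma pkernel_factor:
  "pkernel r (cos a) (cos b) =
    (1 - 2 * r * cos (a + b) + r\<^sup>2) * (1 - 2 * r * cos (a - b) + r\<^sup>2)"
proof -
  have s: "(sin a)\<^sup>2 = 1 - (cos a)\<^sup>2" "(sin b)\<^sup>2 = 1 - (cos b)\<^sup>2"
    by (simp_all add: sin_squared_eq)
  have "cos (a + b) * cos (a - b) = (cos a)\<^sup>2 * (cos b)\<^sup>2 - (sin a)\<^sup>2 * (sin b)\<^sup>2"
    by (simp add: cos_add cos_diff algebra_simps power2_eq_square)
  also have "\<dots> = (cos a)\<^sup>2 + (cos b)\<^sup>2 - 1"
    unfolding s by (simp add: algebra_simps)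
  finally have p: "cos (a + b) * cos (a - b) = (cos a)\<^sup>2 + (cos b)\<^sup>2 - 1" .
  have q: "cos (a + b) + cos (a - b) = 2 * cos a * cos b"
    by (simp add: cos_add cos_diff)
  have "(1 - 2 * r * cos (a + b) + r\<^sup>2) * (1 - 2 * r * cos (a - b) + r\<^sup>2) =
      (1 + r\<^sup>2)\<^sup>2 - 2 * r * (1 + r\<^sup>2) * (cos (a + b) + cos (a - b)) + 4 * r\<^sup>2 * (cos (a + b) * cos (a - b))"
    by (simp add: algebra_simps power2_eq_square)
  then show ?thesis unfolding p q pkernel_def by (simp add: algebra_simps)
qed

lemma factor_ge:
  fixes r t :: real
  assumes "0 \<le> r"
  shows "(1 - r)\<^sup>2 \<le> 1 - 2 * r * cos t + r\<^sup>2"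
proof -
  have "r * cos t \<le> r * 1" using assms by (intro mult_left_mono) auto
  then show ?thesis by (simp add: power2_eq_square algebra_simps)
qed

lemma factor_pos:
  fixes r t :: real
  assumes "0 \<le> r" "r < 1"
  shows "0 < 1 - 2 * r * cos t + r\<^sup>2"
  using assms by (intro less_le_trans[OF _ factor_ge]) auto

text \<open>Each of the two factors is at least (1 - r)^2. For fixed r < 1 this keeps the damped
  kernel away from 0, so its logarithm is bounded.\<close>

lemma pkernel_ge_power4:
  assumes "0 \<le> r" "u \<in> {-1..1}" "v \<in> {-1..1}"
  shows "(1 - r) ^ 4 \<le> pkernel r u v"
proof -
  have "(1 - r) ^ 4 = (1 - r)\<^sup>2 * (1 - r)\<^sup>2" by (simp flip: power_add)
  also have "\<dots> \<le> pkernel r (cos (arccos u)) (cos (arccos v))"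
    unfolding pkernel_factor using assms(1)
    by (intro mult_mono factor_ge order_trans[OF zero_le_power2 factor_ge]) auto
  finally show ?thesis using assms by simp
qed

lemma pkernel_pos:
  assumes "0 \<le> r" "r < 1" "u \<in> {-1..1}" "v \<in> {-1..1}"
  shows "0 < pkernel r u v"
  using assms by (intro less_le_trans[OF _ pkernel_ge_power4]) auto

lemma pkernel_le:
  assumes "0 \<le> r" "r < 1" "u \<in> {-1..1}" "v \<in> {-1..1}"
  shows "pkernel r u v \<le> 16"
proof -
  have *: "1 - 2 * r * cos t + r\<^sup>2 \<le> 4" for t
  proof -
    have "r * (-1) \<le> r * cos t" using assms by (intro mult_left_mono) auto
    moreover have "r\<^sup>2 \<le> 1" using assms by (simp add: power_le_one)
    ultimately show ?thesis using assms by simp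
  qed
  have "pkernel r (cos (arccos u)) (cos (arccos v)) \<le> 4 * 4"
    unfolding pkernel_factor by (intro mult_mono * less_imp_le factor_pos assms) simp_all
  then show ?thesis using assms by simp
qed

text \<open>A lower bound that does not degenerate as r tends to 1. Each factor is at least half of
  its value at r = 1, and the factors at r = 1 multiply to 4 (u - v)^2.\<close>

lemma pkernel_ge:
  assumes "1 / 2 \<le> r" "r < 1" "u \<in> {-1..1}" "v \<in> {-1..1}"
  shows "(u - v)\<^sup>2 \<le> pkernel r u v"
proof -
  have *: "1 - cos t \<le> 1 - 2 * r * cos t + r\<^sup>2" for t
  proof -
    \<comment> \<open>This is the difference of the two sides; the coefficient 2 r - 1 is where r
      \<ge> 1/2 enters.\<close>
    have "0 \<le> (1 - r)\<^sup>2 + (2 * r - 1) * (1 - cos t)"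
      using assms by (intro add_nonneg_nonneg mult_nonneg_nonneg) auto
    then show ?thesis by (simp add: power2_eq_square algebra_simps)
  qed
  define a b where "a = arccos u" and "b = arccos v"
  have uv: "u = cos a" "v = cos b" using assms by (simp_all add: a_def b_def)
  \<comment> \<open>At r = 1 the two factors are 2 (1 - cos (a + b)) and 2 (1 - cos (a - b)), which
    accounts for the 4.\<close>
  have "(u - v)\<^sup>2 = pkernel 1 u v / 4" by (simp add: pkernel_def power2_eq_square algebra_simps)
  also have "\<dots> = (1 - cos (a + b)) * (1 - cos (a - b))"
    unfolding uv pkernel_factor by (simp add: field_simps)
  also have "\<dots> \<le> pkernel r u v" unfolding uv pkernel_factor using assms
    by (intro mult_mono *) (auto intro!: less_imp_le factor_pos)
  finally show ?thesis .
qed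

text \<open>The logarithm of the factorization is a sum of two cosine series, at a + b and a - b;
  the product formula for cosines merges them into products of Chebyshev polynomials.\<close>

lemma pkernel_series:
  assumes "0 \<le> r" "r < 1" "u \<in> {-1..1}" "v \<in> {-1..1}"
  shows "(\<lambda>n. 4 * r ^ Suc n / real (Suc n) * (cheb (Suc n) u * cheb (Suc n) v)) sums
     - ln (pkernel r u v)"
proof -
  define a b where "a = arccos u" and "b = arccos v"
  have uv: "u = cos a" "v = cos b" using assms by (simp_all add: a_def b_def)
  have ch: "cheb n u = cos (real n * a)" "cheb n v = cos (real n * b)" for n
    by (simp_all only: uv cheb_cos)
  have product: "2 * c * (cos x * cos y) = c * cos (x + y) + c * cos (x - y)" for c x y :: real
    by (simp add: cos_add cos_diff algebra_simps)
  have eq: "4 * r ^ Suc n / real (Suc n) * (cheb (Suc n) u * cheb (Suc n) v) =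
     2 * r ^ Suc n / real (Suc n) * cos (real (Suc n) * (a + b)) +
     2 * r ^ Suc n / real (Suc n) * cos (real (Suc n) * (a - b))" for n
    using product[of "2 * r ^ Suc n / real (Suc n)" "real (Suc n) * a" "real (Suc n) * b"]
    by (simp only: ch distrib_left right_diff_distrib times_divide_eq_right mult.assoc[symmetric])
  have pos: "0 < 1 - 2 * r * cos t + r\<^sup>2" for t using assms by (intro factor_pos)
  have "- ln (pkernel r u v) = - ln (1 - 2 * r * cos (a + b) + r\<^sup>2) + - ln (1 - 2 * r * cos (a - b) + r\<^sup>2)"
    unfolding uv pkernel_factor using pos[of "a+b"] pos[of "a-b"] by (simp add: ln_mult)
  show ?thesis unfolding eq \<open>- ln (pkernel r u v) = _\<close> by (intro sums_add cos_series_ln assms)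
qed

lemma pkernel_tendsto:
  assumes "(r \<longlongrightarrow> 1) F"
  shows "((\<lambda>x. pkernel (r x) u v) \<longlongrightarrow> 4 * (u - v)\<^sup>2) F"
proof -
  have "((\<lambda>x. pkernel (r x) u v) \<longlongrightarrow> pkernel 1 u v) F"
    unfolding pkernel_def by (intro tendsto_intros assms)
  moreover have "pkernel 1 u v = 4 * (u - v)\<^sup>2"
    by (simp add: pkernel_def power2_eq_square algebra_simps)
  ultimately show ?thesis by simp
qed

subsection \<open>Energies of designs\<close>

text \<open>The predicate \<open>design\<close> as a locale, so that the theory of product
  probability spaces applies to the double integrals.\<close>

locale design_measure = prob_space \<xi> for \<xi> :: "real measure" +
  assumes sets_eq: "sets \<xi> = sets (restrict_space borel {-1..1})"
begin

sublocale product: pair_prob_space \<xi> \<xi> ..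

lemma space_eq: "space \<xi> = {-1..1}"
  using sets_eq_imp_space_eq[OF sets_eq] by (simp add: space_restrict_space)

text \<open>The sigma-algebra of a design lives on [-1,1] only. Composing with this map makes Borel
  functions on the whole line available.\<close>

lemma measurable_id_borel [measurable]: "(\<lambda>x. x) \<in> borel_measurable \<xi>"
  unfolding measurable_cong_sets[OF sets_eq refl] by (rule measurable_restrict_space1) simp

lemma measurable_fst_borel [measurable]: "fst \<in> borel_measurable (\<xi> \<Otimes>\<^sub>M \<xi>)"
  using measurable_compose[OF measurable_fst measurable_id_borel] by simp

lemma measurable_snd_borel [measurable]: "snd \<in> borel_measurable (\<xi> \<Otimes>\<^sub>M \<xi>)"
  using measurable_compose[OF measurable_snd measurable_id_borel] by simp

lemma measurable_fst_comp:
  "f \<in> borel_measurable borel \<Longrightarrow> (\<lambda>z. f (fst z)) \<in> borel_measurable (\<xi> \<Otimes>\<^sub>M \<xi>)"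
  by (rule measurable_compose[OF measurable_fst_borel])

lemma measurable_snd_comp:
  "f \<in> borel_measurable borel \<Longrightarrow> (\<lambda>z. f (snd z)) \<in> borel_measurable (\<xi> \<Otimes>\<^sub>M \<xi>)"
  by (rule measurable_compose[OF measurable_snd_borel])

lemma integrable_bounded_borel:
  fixes f :: "real \<Rightarrow> real"
  assumes [measurable]: "f \<in> borel_measurable borel" and "\<And>x. x \<in> {-1..1} \<Longrightarrow> \<bar>f x\<bar> \<le> C"
  shows "integrable \<xi> f"
proof (rule integrable_const_bound[of _ C])
  show "f \<in> borel_measurable \<xi>" by (rule measurable_compose[OF measurable_id_borel]) fact
  show "AE x in \<xi>. norm (f x) \<le> C" using assms(2) by (intro AE_I2) (simp add: space_eq)
qed

lemma integrable_cont:
  fixes f :: "real \<Rightarrow> real"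
  assumes "continuous_on UNIV f"
  shows "integrable \<xi> f"
proof -
  have "compact (f ` {-1..1})"
    using assms by (intro compact_continuous_image continuous_on_subset[OF assms]) auto
  then obtain C where "\<forall>y\<in>f ` {-1..1}. norm y \<le> C"
    using compact_imp_bounded bounded_iff by metis
  then show ?thesis
    using assms by (intro integrable_bounded_borel[of _ C] borel_measurable_continuous_onI) auto
qed

lemma product_integral:
  fixes f g :: "real \<Rightarrow> real"
  assumes int: "integrable (\<xi> \<Otimes>\<^sub>M \<xi>) (\<lambda>z. f (fst z) * g (snd z))"
  shows "(\<integral>z. f (fst z) * g (snd z) \<partial>(\<xi> \<Otimes>\<^sub>M \<xi>)) = (\<integral>x. f x \<partial>\<xi>) * (\<integral>x. g x \<partial>\<xi>)"
  using product.integral_fst'[OF int] by simp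

text \<open>Termwise integration of \<open>pkernel_series\<close> against g(u) g(v). The damping
  gives the summable majorant \<open>4 * C\<^sup>2 * r ^ Suc n\<close>, and each term factors over
  the product measure into the square of a single integral. All weights are nonnegative, so the
  smoothed energy is a nonnegative quadratic form.\<close>

lemma sums_smoothed_energy:
  fixes g :: "real \<Rightarrow> real"
  assumes r: "0 \<le> r" "r < 1"
    and g [measurable]: "g \<in> borel_measurable borel"
    and C: "\<And>x. x \<in> {-1..1} \<Longrightarrow> \<bar>g x\<bar> \<le> C"
  shows "(\<lambda>n. 4 * r ^ Suc n / real (Suc n) * (\<integral>x. cheb (Suc n) x * g x \<partial>\<xi>)\<^sup>2) sums
     (\<integral>z. - ln (pkernel r (fst z) (snd z)) * (g (fst z) * g (snd z)) \<partial>(\<xi> \<Otimes>\<^sub>M \<xi>))"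
proof -
  have C0: "0 \<le> C" using C[of 0] by simp
  define h where "h n x = cheb (Suc n) x * g x" for n x
  have h_meas [measurable]: "h n \<in> borel_measurable borel" for n unfolding h_def by measurable
  have h_le: "\<bar>h n x\<bar> \<le> C" if "x \<in> {-1..1}" for n x
    using mult_mono[OF abs_cheb_le_1[OF that, of "Suc n"] C[OF that]] by (simp add: h_def abs_mult)
  note [measurable] = measurable_fst_comp[OF h_meas] measurable_snd_comp[OF h_meas]
  define F where "F n z = 4 * r ^ Suc n / real (Suc n) * (h n (fst z) * h n (snd z))" for n z
  have F_le: "norm (F n z) \<le> 4 * C\<^sup>2 * r ^ Suc n" if "z \<in> space (\<xi> \<Otimes>\<^sub>M \<xi>)" for n z
  proof -
    have z: "fst z \<in> {-1..1}" "snd z \<in> {-1..1}" using that by (auto simp: space_pair_measure space_eq)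
    have "4 * r ^ Suc n / real (Suc n) \<le> 4 * r ^ Suc n"
      using divide_left_mono[of 1 "real (Suc n)" "4 * r ^ Suc n"] r by simp
    moreover have "\<bar>h n (fst z)\<bar> * \<bar>h n (snd z)\<bar> \<le> C * C"
      by (intro mult_mono h_le z) (use C0 in auto)
    ultimately have "4 * r ^ Suc n / real (Suc n) * (\<bar>h n (fst z)\<bar> * \<bar>h n (snd z)\<bar>) \<le> 4 * r ^ Suc n * (C * C)"
      by (rule mult_mono) (use r C0 in auto)
    then show ?thesis using r by (simp add: F_def abs_mult power2_eq_square mult_ac)
  qed
  have F_int: "integrable (\<xi> \<Otimes>\<^sub>M \<xi>) (F n)" for n
  proof (rule product.integrable_const_bound)
    show "AE z in \<xi> \<Otimes>\<^sub>M \<xi>. norm (F n z) \<le> 4 * C\<^sup>2 * r ^ Suc n" by (intro AE_I2 F_le)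
    show "F n \<in> borel_measurable (\<xi> \<Otimes>\<^sub>M \<xi>)" unfolding F_def by measurable
  qed
  have hh_int: "integrable (\<xi> \<Otimes>\<^sub>M \<xi>) (\<lambda>z. h n (fst z) * h n (snd z))" for n
  proof (rule product.integrable_const_bound[of _ "C * C"])
    show "AE z in \<xi> \<Otimes>\<^sub>M \<xi>. norm (h n (fst z) * h n (snd z)) \<le> C * C"
      by (intro AE_I2) (auto simp: space_pair_measure space_eq abs_mult C0 intro!: mult_mono h_le)
  qed measurable
  have summ: "summable (\<lambda>n. 4 * C\<^sup>2 * r ^ Suc n)"
    using r by (intro summable_mult) (subst summable_Suc_iff, simp add: summable_geometric)
  have "(\<lambda>n. \<integral>z. F n z \<partial>(\<xi> \<Otimes>\<^sub>M \<xi>)) sums (\<integral>z. (\<Sum>n. F n z) \<partial>(\<xi> \<Otimes>\<^sub>M \<xi>))"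
  proof (rule sums_integral)
    show "AE z in \<xi> \<Otimes>\<^sub>M \<xi>. summable (\<lambda>n. norm (F n z))"
      by (intro AE_I2 summable_comparison_test'[OF summ]) (use F_le in auto)
    show "summable (\<lambda>n. \<integral>z. norm (F n z) \<partial>(\<xi> \<Otimes>\<^sub>M \<xi>))"
    proof (rule summable_comparison_test'[OF summ])
      fix n
      have "(\<integral>z. norm (F n z) \<partial>(\<xi> \<Otimes>\<^sub>M \<xi>)) \<le> (\<integral>z. 4 * C\<^sup>2 * r ^ Suc n \<partial>(\<xi> \<Otimes>\<^sub>M \<xi>))"
        by (intro integral_mono F_le integrable_norm F_int) auto
      then show "norm (\<integral>z. norm (F n z) \<partial>(\<xi> \<Otimes>\<^sub>M \<xi>)) \<le> 4 * C\<^sup>2 * r ^ Suc n"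
        by (simp add: product.prob_space)
    qed
  qed (rule F_int)
  moreover have "(\<integral>z. F n z \<partial>(\<xi> \<Otimes>\<^sub>M \<xi>)) = 4 * r ^ Suc n / real (Suc n) * (\<integral>x. cheb (Suc n) x * g x \<partial>\<xi>)\<^sup>2" for n
    unfolding F_def by (subst integral_mult_right_zero, subst product_integral[OF hh_int])
      (simp add: h_def[abs_def] power2_eq_square)
  moreover have "(\<integral>z. (\<Sum>n. F n z) \<partial>(\<xi> \<Otimes>\<^sub>M \<xi>)) =
     (\<integral>z. - ln (pkernel r (fst z) (snd z)) * (g (fst z) * g (snd z)) \<partial>(\<xi> \<Otimes>\<^sub>M \<xi>))"
  proof (rule Bochner_Integration.integral_cong[OF refl])
    fix z assume "z \<in> space (\<xi> \<Otimes>\<^sub>M \<xi>)"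
    then have z: "fst z \<in> {-1..1}" "snd z \<in> {-1..1}" by (auto simp: space_pair_measure space_eq)
    have "(\<lambda>n. F n z) sums (- ln (pkernel r (fst z) (snd z)) * (g (fst z) * g (snd z)))"
      using sums_mult2[OF pkernel_series[OF r z], of "g (fst z) * g (snd z)"]
      by (simp add: F_def h_def mult_ac)
    then show "(\<Sum>n. F n z) = - ln (pkernel r (fst z) (snd z)) * (g (fst z) * g (snd z))"
      by (rule sums_unique[symmetric])
  qed
  ultimately show ?thesis by simp
qed

end

section \<open>Letting the damping radius tend to 1\<close>

definition radius :: "nat \<Rightarrow> real" where
  "radius k = 1 - 1 / (real k + 2)"

text \<open>The bound 1/2, attained at k = 0, is what \<open>pkernel_ge\<close> asks for; the offset
  2 in \<open>radius\<close> provides it.\<close>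

lemma radius_bounds: "1 / 2 \<le> radius k" "0 \<le> radius k" "radius k < 1"
proof -
  have "1 / (real k + 2) \<le> 1 / 2" by (intro divide_left_mono) auto
  then show "1 / 2 \<le> radius k" "0 \<le> radius k" by (simp_all add: radius_def)
  show "radius k < 1" by (simp add: radius_def)
qed

lemma radius_tendsto: "radius \<longlonglongrightarrow> 1"
proof -
  have "(\<lambda>k. 1 - 1 / real (k + 2)) \<longlonglongrightarrow> 1 - 0"
    by (intro tendsto_intros LIMSEQ_ignore_initial_segment[OF lim_1_over_n])
  then show ?thesis by (simp add: radius_def[abs_def] add.commute)
qed

lemma ln_pkernel_tendsto:
  assumes "u \<noteq> v"
  shows "(\<lambda>k. ln (pkernel (radius k) u v)) \<longlonglongrightarrow> ln (4 * (u - v)\<^sup>2)"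
  using assms by (intro tendsto_ln pkernel_tendsto radius_tendsto) auto

text \<open>The bound is free of k, so it dominates the whole sequence of damped kernels.\<close>

lemma abs_ln_pkernel_le:
  assumes "u \<in> {-1..1}" "v \<in> {-1..1}" "u \<noteq> v"
  shows "\<bar>ln (pkernel (radius k) u v)\<bar> \<le> \<bar>ln ((u - v)\<^sup>2)\<bar> + ln 16"
  using abs_ln_le[OF _ pkernel_ge[of "radius k" u v] pkernel_le[of "radius k" u v]] assms radius_bounds[of k]
  by simp

context design_measure
begin

lemma in_space: "z \<in> space (\<xi> \<Otimes>\<^sub>M \<xi>) \<Longrightarrow> fst z \<in> {-1..1} \<and> snd z \<in> {-1..1}"
  by (auto simp: space_pair_measure space_eq)

text \<open>Dominated convergence off the diagonal, with majorant (|ln ((u - v)^2)| + ln 16) C^2,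
  yields both integrability of the limit and convergence of the integrals.\<close>

lemma
  fixes g :: "real \<Rightarrow> real"
  assumes off_diagonal: "AE z in \<xi> \<Otimes>\<^sub>M \<xi>. fst z \<noteq> snd z"
    and ln_int: "integrable (\<xi> \<Otimes>\<^sub>M \<xi>) (\<lambda>z. ln ((fst z - snd z)\<^sup>2))"
    and g: "g \<in> borel_measurable borel"
    and C: "\<And>x. x \<in> {-1..1} \<Longrightarrow> \<bar>g x\<bar> \<le> C"
  shows integrable_ln_energy:
      "integrable (\<xi> \<Otimes>\<^sub>M \<xi>) (\<lambda>z. - ln (4 * (fst z - snd z)\<^sup>2) * (g (fst z) * g (snd z)))"
    and smoothed_energy_tendsto:
      "(\<lambda>k. \<integral>z. - ln (pkernel (radius k) (fst z) (snd z)) * (g (fst z) * g (snd z)) \<partial>(\<xi> \<Otimes>\<^sub>M \<xi>))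
        \<longlonglongrightarrow> (\<integral>z. - ln (4 * (fst z - snd z)\<^sup>2) * (g (fst z) * g (snd z)) \<partial>(\<xi> \<Otimes>\<^sub>M \<xi>))"
proof -
  have C0: "0 \<le> C" using C[of 0] by simp
  note [measurable] = measurable_fst_comp[OF g] measurable_snd_comp[OF g]
  let ?w = "\<lambda>z. (\<bar>ln ((fst z - snd z)\<^sup>2)\<bar> + ln 16) * (C * C)"
  have w: "integrable (\<xi> \<Otimes>\<^sub>M \<xi>) ?w"
    by (intro integrable_mult_left Bochner_Integration.integrable_add integrable_abs ln_int) simp
  have bound: "AE z in \<xi> \<Otimes>\<^sub>M \<xi>. norm (- ln (pkernel (radius k) (fst z) (snd z)) * (g (fst z) * g (snd z))) \<le> ?w z" for k
    using off_diagonal AE_space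
  proof eventually_elim
    case (elim z)
    then have z: "fst z \<in> {-1..1}" "snd z \<in> {-1..1}" using in_space by auto
    have "\<bar>ln (pkernel (radius k) (fst z) (snd z))\<bar> * (\<bar>g (fst z)\<bar> * \<bar>g (snd z)\<bar>) \<le> ?w z"
      using z elim C0 by (intro mult_mono abs_ln_pkernel_le C) auto
    then show ?case by (simp add: abs_mult)
  qed
  have lim: "AE z in \<xi> \<Otimes>\<^sub>M \<xi>. (\<lambda>k. - ln (pkernel (radius k) (fst z) (snd z)) * (g (fst z) * g (snd z)))
      \<longlonglongrightarrow> - ln (4 * (fst z - snd z)\<^sup>2) * (g (fst z) * g (snd z))"
    using off_diagonal by eventually_elim (intro tendsto_intros ln_pkernel_tendsto)
  show "integrable (\<xi> \<Otimes>\<^sub>M \<xi>) (\<lambda>z. - ln (4 * (fst z - snd z)\<^sup>2) * (g (fst z) * g (snd z)))"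
    by (rule integrable_dominated_convergence[OF _ _ w lim bound]) measurable
  show "(\<lambda>k. \<integral>z. - ln (pkernel (radius k) (fst z) (snd z)) * (g (fst z) * g (snd z)) \<partial>(\<xi> \<Otimes>\<^sub>M \<xi>))
        \<longlonglongrightarrow> (\<integral>z. - ln (4 * (fst z - snd z)\<^sup>2) * (g (fst z) * g (snd z)) \<partial>(\<xi> \<Otimes>\<^sub>M \<xi>))"
    by (rule integral_dominated_convergence[OF _ _ w lim bound]) measurable
qed

lemma integrable_ln_pkernel:
  assumes r: "0 \<le> r" "r < 1"
  shows "integrable (\<xi> \<Otimes>\<^sub>M \<xi>) (\<lambda>z. ln (pkernel r (fst z) (snd z)))"
proof (rule product.integrable_const_bound)
  have "\<bar>ln (pkernel r u v)\<bar> \<le> \<bar>ln ((1 - r) ^ 4)\<bar> + ln 16"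
    if uv: "u \<in> {-1..1}" "v \<in> {-1..1}" for u v
    using abs_ln_le[OF _ pkernel_ge_power4[of r u v] pkernel_le[of r u v]] r uv by simp
  then show "AE z in \<xi> \<Otimes>\<^sub>M \<xi>. norm (ln (pkernel r (fst z) (snd z))) \<le> \<bar>ln ((1 - r) ^ 4)\<bar> + ln 16"
    using in_space by (intro AE_I2) auto
qed measurable

text \<open>Yields the finite energy of the arcsine design without computing its logarithmic potential.\<close>

lemma integrable_ln_of_bounded_smoothing:
  assumes off_diagonal: "AE z in \<xi> \<Otimes>\<^sub>M \<xi>. fst z \<noteq> snd z"
    and bound: "\<And>k. (\<integral>z. - ln (pkernel (radius k) (fst z) (snd z)) \<partial>(\<xi> \<Otimes>\<^sub>M \<xi>)) \<le> C"
  shows "integrable (\<xi> \<Otimes>\<^sub>M \<xi>) (\<lambda>z. ln ((fst z - snd z)\<^sup>2))"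
proof -
  \<comment> \<open>The offset ln 16 bounds the logarithm of every damped kernel from above. It
    makes \<open>F k\<close> nonnegative, as Fatou's lemma requires.\<close>
  define f where "f z = ln 16 - ln (4 * (fst z - snd z)\<^sup>2)" for z :: "real \<times> real"
  define F where "F k z = ln 16 - ln (pkernel (radius k) (fst z) (snd z))" for k and z :: "real \<times> real"
  have [measurable]: "f \<in> borel_measurable (\<xi> \<Otimes>\<^sub>M \<xi>)" "F k \<in> borel_measurable (\<xi> \<Otimes>\<^sub>M \<xi>)" for k
    unfolding f_def F_def by measurable
  have F_nonneg: "0 \<le> F k z" if "z \<in> space (\<xi> \<Otimes>\<^sub>M \<xi>)" for k z
  proof -
    have "0 < pkernel (radius k) (fst z) (snd z)" "pkernel (radius k) (fst z) (snd z) \<le> 16"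
      using in_space[OF that] radius_bounds[of k] by (auto intro!: pkernel_pos pkernel_le)
    then show ?thesis by (simp add: F_def)
  qed
  have F_lim: "AE z in \<xi> \<Otimes>\<^sub>M \<xi>. (\<lambda>k. F k z) \<longlonglongrightarrow> f z"
    using off_diagonal unfolding F_def f_def by eventually_elim (intro tendsto_intros ln_pkernel_tendsto)
  have F_int: "integrable (\<xi> \<Otimes>\<^sub>M \<xi>) (F k)" for k
    unfolding F_def by (intro Bochner_Integration.integrable_diff integrable_ln_pkernel radius_bounds) simp
  have F_le: "(\<integral>\<^sup>+z. ennreal (F k z) \<partial>(\<xi> \<Otimes>\<^sub>M \<xi>)) \<le> ennreal (ln 16 + C)" for k
  proof -
    have "(\<integral>z. F k z \<partial>(\<xi> \<Otimes>\<^sub>M \<xi>)) = ln 16 + (\<integral>z. - ln (pkernel (radius k) (fst z) (snd z)) \<partial>(\<xi> \<Otimes>\<^sub>M \<xi>))"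
      unfolding F_def
      by (subst Bochner_Integration.integral_diff)
        (simp_all add: integrable_ln_pkernel radius_bounds product.prob_space)
    then have "(\<integral>z. F k z \<partial>(\<xi> \<Otimes>\<^sub>M \<xi>)) \<le> ln 16 + C" using bound[of k] by simp
    then show ?thesis
      by (subst nn_integral_eq_integral[OF F_int]) (auto intro!: AE_I2 F_nonneg ennreal_leI)
  qed
  have "(\<integral>\<^sup>+z. ennreal (f z) \<partial>(\<xi> \<Otimes>\<^sub>M \<xi>)) = (\<integral>\<^sup>+z. liminf (\<lambda>k. ennreal (F k z)) \<partial>(\<xi> \<Otimes>\<^sub>M \<xi>))"
  proof (rule nn_integral_cong_AE)
    show "AE z in \<xi> \<Otimes>\<^sub>M \<xi>. ennreal (f z) = liminf (\<lambda>k. ennreal (F k z))"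
      using F_lim
    proof eventually_elim
      case (elim z)
      then show ?case using lim_imp_Liminf[OF sequentially_bot tendsto_ennrealI[OF elim]] by simp
    qed
  qed
  also have "\<dots> \<le> liminf (\<lambda>k. \<integral>\<^sup>+z. ennreal (F k z) \<partial>(\<xi> \<Otimes>\<^sub>M \<xi>))"
    by (intro nn_integral_liminf) measurable
  also have "\<dots> \<le> liminf (\<lambda>k::nat. ennreal (ln 16 + C))"
    by (intro Liminf_mono always_eventually allI F_le)
  also have "\<dots> = ennreal (ln 16 + C)" by (intro lim_imp_Liminf) auto
  finally have "(\<integral>\<^sup>+z. ennreal (f z) \<partial>(\<xi> \<Otimes>\<^sub>M \<xi>)) < \<infinity>" by (simp add: le_less_trans)
  moreover have "AE z in \<xi> \<Otimes>\<^sub>M \<xi>. 0 \<le> f z"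
    using F_lim AE_space
  proof eventually_elim
    case (elim z)
    then show ?case by (intro LIMSEQ_le_const[OF elim(1)]) (auto intro: F_nonneg)
  qed
  ultimately have f_int: "integrable (\<xi> \<Otimes>\<^sub>M \<xi>) f"
    by (intro integrableI_nonneg) auto
  \<comment> \<open>Off the diagonal ln (4 (u - v)^2) splits into ln 4 + ln ((u - v)^2), so the
    logarithm is recovered from \<open>f\<close> up to constants.\<close>
  have "AE z in \<xi> \<Otimes>\<^sub>M \<xi>. ln 16 - ln 4 - f z = ln ((fst z - snd z)\<^sup>2)"
    using off_diagonal by eventually_elim (simp add: f_def ln_mult)
  moreover have "integrable (\<xi> \<Otimes>\<^sub>M \<xi>) (\<lambda>z. ln 16 - ln 4 - f z)"
    by (intro Bochner_Integration.integrable_diff f_int) auto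
  ultimately show ?thesis
    by (subst (asm) integrable_cong_AE) auto
qed

end

text \<open>At each radius the two series are compared term by term: below m the coefficients agree,
  and from m on those of \<xi> vanish while those of \<eta> are nonnegative multiples of squares.
  The inequality survives the limit.\<close>

lemma ln_energy_le:
  fixes g h :: "real \<Rightarrow> real"
  assumes "design_measure \<xi>" "design_measure \<eta>"
    and off: "AE z in \<xi> \<Otimes>\<^sub>M \<xi>. fst z \<noteq> snd z" "AE z in \<eta> \<Otimes>\<^sub>M \<eta>. fst z \<noteq> snd z"
    and int: "integrable (\<xi> \<Otimes>\<^sub>M \<xi>) (\<lambda>z. ln ((fst z - snd z)\<^sup>2))"
      "integrable (\<eta> \<Otimes>\<^sub>M \<eta>) (\<lambda>z. ln ((fst z - snd z)\<^sup>2))"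
    and meas: "g \<in> borel_measurable borel" "h \<in> borel_measurable borel"
    and bound: "\<And>x. x \<in> {-1..1} \<Longrightarrow> \<bar>g x\<bar> \<le> C" "\<And>x. x \<in> {-1..1} \<Longrightarrow> \<bar>h x\<bar> \<le> C'"
    and low: "\<And>n. n < m \<Longrightarrow> (\<integral>x. cheb n x * g x \<partial>\<xi>) = (\<integral>x. cheb n x * h x \<partial>\<eta>)"
    and high: "\<And>n. m \<le> n \<Longrightarrow> (\<integral>x. cheb n x * g x \<partial>\<xi>) = 0"
  shows "(\<integral>z. - ln (4 * (fst z - snd z)\<^sup>2) * (g (fst z) * g (snd z)) \<partial>(\<xi> \<Otimes>\<^sub>M \<xi>))
    \<le> (\<integral>z. - ln (4 * (fst z - snd z)\<^sup>2) * (h (fst z) * h (snd z)) \<partial>(\<eta> \<Otimes>\<^sub>M \<eta>))"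
proof -
  interpret X: design_measure \<xi> by fact
  interpret Y: design_measure \<eta> by fact
  have "(\<integral>z. - ln (pkernel (radius k) (fst z) (snd z)) * (g (fst z) * g (snd z)) \<partial>(\<xi> \<Otimes>\<^sub>M \<xi>))
    \<le> (\<integral>z. - ln (pkernel (radius k) (fst z) (snd z)) * (h (fst z) * h (snd z)) \<partial>(\<eta> \<Otimes>\<^sub>M \<eta>))" for k
  proof (rule sums_le)
    show "(\<lambda>n. 4 * radius k ^ Suc n / real (Suc n) * (\<integral>x. cheb (Suc n) x * g x \<partial>\<xi>)\<^sup>2) sums
      (\<integral>z. - ln (pkernel (radius k) (fst z) (snd z)) * (g (fst z) * g (snd z)) \<partial>(\<xi> \<Otimes>\<^sub>M \<xi>))"
      using radius_bounds meas bound by (intro X.sums_smoothed_energy)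
    show "(\<lambda>n. 4 * radius k ^ Suc n / real (Suc n) * (\<integral>x. cheb (Suc n) x * h x \<partial>\<eta>)\<^sup>2) sums
      (\<integral>z. - ln (pkernel (radius k) (fst z) (snd z)) * (h (fst z) * h (snd z)) \<partial>(\<eta> \<Otimes>\<^sub>M \<eta>))"
      using radius_bounds meas bound by (intro Y.sums_smoothed_energy)
    show "4 * radius k ^ Suc n / real (Suc n) * (\<integral>x. cheb (Suc n) x * g x \<partial>\<xi>)\<^sup>2
      \<le> 4 * radius k ^ Suc n / real (Suc n) * (\<integral>x. cheb (Suc n) x * h x \<partial>\<eta>)\<^sup>2" for n
      using low[of "Suc n"] high[of "Suc n"] radius_bounds[of k] by (cases "Suc n < m") auto
  qed
  then show ?thesis
    by (intro LIMSEQ_le[OF X.smoothed_energy_tendsto[OF off(1) int(1) meas(1) bound(1)]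
          Y.smoothed_energy_tendsto[OF off(2) int(2) meas(2) bound(2)]]) auto
qed

subsection \<open>The arcsine design\<close>

text \<open>A real-valued density, for use in Bochner integrals. The indicator keeps it nonnegative
  on the whole line, since \<open>sqrt\<close> is negative at negative arguments.\<close>

definition arcsine_density :: "real \<Rightarrow> real" where
  "arcsine_density x = indicator {-1<..<1} x * (1 / (pi * sqrt (1 - x\<^sup>2)))"

lemma measurable_arcsine_density [measurable]: "arcsine_density \<in> borel_measurable borel"
  unfolding arcsine_density_def by measurable

lemma arcsine_density_nonneg: "0 \<le> arcsine_density x"
proof -
  have "0 \<le> 1 - x\<^sup>2" if "-1 < x" "x < 1"
    using that abs_square_le_1[of x] by simp
  then show ?thesis by (auto simp: arcsine_density_def indicator_def)
qed

lemma arcsine_design_eq: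
  "arcsine_design = density (restrict_space lborel {-1..1}) (\<lambda>x. ennreal (arcsine_density x))"
  unfolding arcsine_design_def
  by (intro arg_cong2[where f = density] refl ext) (simp add: arcsine_density_def indicator_def)

lemma one_minus_square_pos: "-1 < x \<Longrightarrow> x < 1 \<Longrightarrow> 0 < 1 - (x::real)\<^sup>2"
proof -
  assume "-1 < x" "x < 1"
  then have "x\<^sup>2 < 1" by (intro abs_square_less_1[THEN iffD2]) auto
  then show ?thesis by simp
qed

lemma arcsine_weight_pos: "-1 < x \<Longrightarrow> x < 1 \<Longrightarrow> 0 < pi * sqrt (1 - x\<^sup>2)"
  by (intro mult_pos_pos real_sqrt_gt_zero one_minus_square_pos) auto

text \<open>Boundary values for the fundamental theorem of calculus on (-1,1), where the weight is
  unbounded at both ends and the integrals are improper.\<close>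

lemma arccos_tendsto:
  "(arccos \<longlongrightarrow> pi) (at_right (-1))" "(arccos \<longlongrightarrow> 0) (at_left 1)"
proof -
  have "\<forall>x\<in>{-1..1}. (arccos \<longlongrightarrow> arccos x) (at x within {-1..1})"
    using continuous_on_arccos' unfolding continuous_on_def .
  from this[rule_format, of "-1"] this[rule_format, of 1] show "(arccos \<longlongrightarrow> pi) (at_right (-1))" "(arccos \<longlongrightarrow> 0) (at_left 1)"
    by (simp_all add: at_within_Icc_at_right at_within_Icc_at_left)
qed

lemma arccos_antiderivative:
  assumes "-1 < x" "x < 1"
  shows "((\<lambda>x. - arccos x / pi) has_real_derivative 1 / (pi * sqrt (1 - x\<^sup>2))) (at x)"
  using one_minus_square_pos[OF assms] assms
  by (auto intro!: derivative_eq_intros simp: divide_simps)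

lemma isCont_arcsine_weight:
  assumes "-1 < x" "x < 1"
  shows "isCont (\<lambda>x. 1 / (pi * sqrt (1 - x\<^sup>2))) x"
  using one_minus_square_pos[OF assms] by (intro continuous_intros) auto

text \<open>The antiderivative \<open>- arccos x / pi\<close> runs from -1 to 0. Because the weight
  is positive, the same theorem also yields integrability.\<close>

lemma arcsine_weight_integral:
  "set_integrable lborel {-1<..<1} (\<lambda>x. 1 / (pi * sqrt (1 - x\<^sup>2)))"
  "(LBINT x=-1..1. 1 / (pi * sqrt (1 - x\<^sup>2))) = 1"
proof -
  let ?F = "\<lambda>x. - arccos x / pi"
  have F: "((?F \<circ> real_of_ereal) \<longlongrightarrow> - 1) (at_right (ereal (-1)))"
    "((?F \<circ> real_of_ereal) \<longlongrightarrow> 0) (at_left (ereal 1))"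
    unfolding ereal_tendsto_simps using arccos_tendsto
    by (auto intro!: tendsto_eq_intros)
  note FTC = interval_integral_FTC_nonneg[of "ereal (-1)" "ereal 1" ?F, OF _ _ _ _ F,
      where f = "\<lambda>x. 1 / (pi * sqrt (1 - x\<^sup>2))"]
  show "set_integrable lborel {-1<..<1} (\<lambda>x. 1 / (pi * sqrt (1 - x\<^sup>2)))"
    using FTC(1) arccos_antiderivative isCont_arcsine_weight
    by (auto simp: einterval_eq less_imp_le arcsine_weight_pos)
  show "(LBINT x=-1..1. 1 / (pi * sqrt (1 - x\<^sup>2))) = 1"
    using FTC(2) arccos_antiderivative isCont_arcsine_weight
    by (auto simp: one_ereal_def less_imp_le arcsine_weight_pos)
qed

lemma arcsine_density_integrable: "integrable lborel arcsine_density"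
  using arcsine_weight_integral(1) by (simp add: set_integrable_def arcsine_density_def[abs_def])

lemma interval_integral_arcsine:
  "(\<integral>x. arcsine_density x * f x \<partial>lborel) = (LBINT x=-1..1. f x / (pi * sqrt (1 - x\<^sup>2)))"
proof -
  have "einterval (-1) 1 = {-1<..<1::real}"
    by (auto simp: einterval_def one_ereal_def)
  moreover have "(-1::ereal) \<le> 1" by (simp add: one_ereal_def)
  ultimately show ?thesis
    unfolding interval_lebesgue_integral_def set_lebesgue_integral_def
    by (auto intro!: Bochner_Integration.integral_cong simp: arcsine_density_def)
qed

lemma arcsine_integral:
  fixes f :: "real \<Rightarrow> real"
  assumes [measurable]: "f \<in> borel_measurable borel"
  shows "(\<integral>x. f x \<partial>arcsine_design) = (\<integral>x. arcsine_density x * f x \<partial>lborel)"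
proof -
  have "(\<integral>x. f x \<partial>arcsine_design) = (\<integral>x. arcsine_density x * f x \<partial>restrict_space lborel {-1..1})"
    unfolding arcsine_design_eq
    by (subst integral_density) (auto intro!: measurable_restrict_space1 arcsine_density_nonneg)
  also have "\<dots> = (\<integral>x. indicator {-1..1} x *\<^sub>R (arcsine_density x * f x) \<partial>lborel)"
    by (intro integral_restrict_space) simp
  also have "\<dots> = (\<integral>x. arcsine_density x * f x \<partial>lborel)"
    by (intro Bochner_Integration.integral_cong refl) (simp add: arcsine_density_def indicator_def)
  finally show ?thesis .
qed

lemma design_measure_arcsine: "design_measure arcsine_design"
proof (intro design_measure.intro design_measure_axioms.intro prob_spaceI)
  show "sets arcsine_design = sets (restrict_space borel {-1..1})"
    unfolding arcsine_design_eq sets_density by (rule sets_restrict_space_cong) simp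
  have "emeasure arcsine_design (space arcsine_design) =
      (\<integral>\<^sup>+x. ennreal (arcsine_density x) \<partial>restrict_space lborel {-1..1})"
    unfolding arcsine_design_eq
    by (subst emeasure_density)
      (auto intro!: nn_integral_cong measurable_restrict_space1 simp: indicator_def sets_restrict_space_iff)
  also have "\<dots> = (\<integral>\<^sup>+x. ennreal (arcsine_density x) * indicator {-1..1} x \<partial>lborel)"
    by (intro nn_integral_restrict_space) simp
  also have "\<dots> = (\<integral>\<^sup>+x. ennreal (arcsine_density x) \<partial>lborel)"
    by (intro nn_integral_cong) (simp add: arcsine_density_def indicator_def)
  also have "\<dots> = ennreal (\<integral>x. arcsine_density x \<partial>lborel)"
    by (intro nn_integral_eq_integral arcsine_density_integrable AE_I2 arcsine_density_nonneg)
  also have "(\<integral>x. arcsine_density x \<partial>lborel) = 1"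
    using interval_integral_arcsine[of "\<lambda>_. 1"] arcsine_weight_integral(2) by simp
  finally show "emeasure arcsine_design (space arcsine_design) = 1" by simp
qed

interpretation arcsine: design_measure arcsine_design
  by (rule design_measure_arcsine)

text \<open>The density is positive exactly on (-1,1), so there the null sets are those of Lebesgue
  measure.\<close>

lemma AE_arcsine_iff:
  assumes [measurable]: "Measurable.pred borel P"
  shows "(AE x in arcsine_design. P x) \<longleftrightarrow> (AE x in lborel. x \<in> {-1<..<1} \<longrightarrow> P x)"
proof -
  have "(AE x in arcsine_design. P x) \<longleftrightarrow>
      (AE x in restrict_space lborel {-1..1}. 0 < ennreal (arcsine_density x) \<longrightarrow> P x)"
    unfolding arcsine_design_eq
    by (subst AE_density) (auto intro!: measurable_restrict_space1)
  also have "\<dots> \<longleftrightarrow> (AE x in lborel. x \<in> {-1..1} \<longrightarrow> 0 < ennreal (arcsine_density x) \<longrightarrow> P x)"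
    by (subst AE_restrict_space_iff) auto
  also have "\<dots> \<longleftrightarrow> (AE x in lborel. x \<in> {-1<..<1} \<longrightarrow> P x)"
    by (intro AE_cong) (auto simp: arcsine_density_def indicator_def arcsine_weight_pos)
  finally show ?thesis .
qed

text \<open>Points are null sets of the arcsine design, so every section of the diagonal is
  null.\<close>

lemma arcsine_off_diagonal: "AE z in arcsine_design \<Otimes>\<^sub>M arcsine_design. fst z \<noteq> snd z"
proof (rule arcsine.product.AE_pair_measure)
  show "{z \<in> space (arcsine_design \<Otimes>\<^sub>M arcsine_design). fst z \<noteq> snd z} \<in> sets (arcsine_design \<Otimes>\<^sub>M arcsine_design)"
    by measurable
  have "AE y in arcsine_design. x \<noteq> y" for x
    using AE_lborel_singleton[of x] by (subst AE_arcsine_iff) auto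
  then show "AE x in arcsine_design. AE y in arcsine_design. fst (x, y) \<noteq> snd (x, y)" by simp
qed

section \<open>Orthogonality of the Chebyshev polynomials under the arcsine design\<close>

lemma arcsine_cheb_integral:
  assumes "0 < n"
  shows "(\<integral>x. cheb n x \<partial>arcsine_design) = 0"
proof -
  let ?f = "\<lambda>x. cheb n x / (pi * sqrt (1 - x\<^sup>2))"
  \<comment> \<open>The substitution x = cos t would give the integral of cos (n t) / pi over
    [0, pi]; this is the corresponding antiderivative in x. It vanishes at both ends, as n arccos x
    tends to n pi and to 0.\<close>
  let ?F = "\<lambda>x. - sin (real n * arccos x) / (real n * pi)"
  have "(\<integral>x. cheb n x \<partial>arcsine_design) = (LBINT x=ereal (-1)..ereal 1. ?f x)"
    by (simp add: arcsine_integral interval_integral_arcsine one_ereal_def)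
  also have "\<dots> = 0 - 0"
  proof (rule interval_integral_FTC_integrable[where F = ?F])
    have lim: "((\<lambda>x. sin (real n * arccos x)) \<longlongrightarrow> 0) (at_right (-1))"
      using tendsto_sin[OF tendsto_mult[OF tendsto_const arccos_tendsto(1)], of "real n"] by simp
    show "((?F \<circ> real_of_ereal) \<longlongrightarrow> 0) (at_right (ereal (-1)))"
      unfolding ereal_tendsto_simps using tendsto_divide[OF tendsto_minus[OF lim] tendsto_const, of "real n * pi"] assms
      by simp
    have lim: "((\<lambda>x. sin (real n * arccos x)) \<longlongrightarrow> 0) (at_left 1)"
      using tendsto_sin[OF tendsto_mult[OF tendsto_const arccos_tendsto(2)], of "real n"] by simp
    show "((?F \<circ> real_of_ereal) \<longlongrightarrow> 0) (at_left (ereal 1))"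
      unfolding ereal_tendsto_simps using tendsto_divide[OF tendsto_minus[OF lim] tendsto_const, of "real n * pi"] assms
      by simp
    have "integrable lborel (\<lambda>x. arcsine_density x * cheb n x)"
    proof (rule Bochner_Integration.integrable_bound[OF arcsine_density_integrable])
      show "AE x in lborel. norm (arcsine_density x * cheb n x) \<le> norm (arcsine_density x)"
        using abs_cheb_le_1[of _ n]
        by (intro AE_I2) (auto simp: arcsine_density_def abs_mult indicator_def mult_left_le divide_right_mono)
    qed (simp_all add: measurable_cheb)
    then show "set_integrable lborel (einterval (ereal (-1)) (ereal 1)) ?f"
      by (simp add: set_integrable_def arcsine_density_def[abs_def] mult.assoc)
    fix x assume "ereal (-1) < ereal x" "ereal x < ereal 1"
    then have x: "-1 < x" "x < 1" by auto
    have "(?F has_real_derivative cos (real n * arccos x) / (pi * sqrt (1 - x\<^sup>2))) (at x)"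
      using one_minus_square_pos[OF x] x assms
      by (auto intro!: derivative_eq_intros simp: divide_simps)
    then show "(?F has_vector_derivative ?f x) (at x)"
      using x by (simp add: cheb_arccos has_real_derivative_iff_has_vector_derivative)
    show "isCont ?f x"
      using one_minus_square_pos[OF x] by (intro continuous_intros isCont_cheb) auto
  qed simp
  finally show ?thesis by simp
qed

text \<open>Induction on j: by the recursion x T_(k+1) = (T_(k+2) + T_k) / 2, which removes one
  factor x. Both new indices still exceed the remaining exponent.\<close>

lemma arcsine_cheb_power_integral:
  "j < n \<Longrightarrow> (\<integral>x. cheb n x * x ^ j \<partial>arcsine_design) = 0"
proof (induction j arbitrary: n)
  case 0
  then show ?case by (simp add: arcsine_cheb_integral)
next
  case (Suc j)
  then obtain k where n: "n = Suc k" and k: "j < k" by (cases n) auto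
  have int: "integrable arcsine_design (\<lambda>x. cheb i x * x ^ j)" for i
    by (intro arcsine.integrable_cont continuous_intros continuous_on_cheb)
  have "(\<integral>x. cheb n x * x ^ Suc j \<partial>arcsine_design) =
      (\<integral>x. (cheb (Suc (Suc k)) x * x ^ j + cheb k x * x ^ j) / 2 \<partial>arcsine_design)"
    by (intro Bochner_Integration.integral_cong refl) (simp add: n field_simps)
  also have "\<dots> = ((\<integral>x. cheb (Suc (Suc k)) x * x ^ j \<partial>arcsine_design) + (\<integral>x. cheb k x * x ^ j \<partial>arcsine_design)) / 2"
    by (subst integral_divide_zero, subst Bochner_Integration.integral_add[OF int int]) simp
  also have "\<dots> = 0" using Suc.IH[of "Suc (Suc k)"] Suc.IH[of k] k by simp
  finally show ?case .
qed

text \<open>With g = 1 every term of the series vanishes, because T_n has mean 0 for n \<ge> 1. All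
  smoothed energies are therefore 0, which is the uniform bound that the Fatou argument
  takes.\<close>

lemma arcsine_ln_integrable:
  "integrable (arcsine_design \<Otimes>\<^sub>M arcsine_design) (\<lambda>z. ln ((fst z - snd z)\<^sup>2))"
proof (rule arcsine.integrable_ln_of_bounded_smoothing[OF arcsine_off_diagonal])
  fix k
  have "(\<lambda>n. 0) sums (\<integral>z. - ln (pkernel (radius k) (fst z) (snd z)) \<partial>(arcsine_design \<Otimes>\<^sub>M arcsine_design))"
    using arcsine.sums_smoothed_energy[OF radius_bounds(2,3), of "\<lambda>_. 1" 1]
    by (simp add: arcsine_cheb_integral)
  from sums_unique2[OF this sums_zero]
  show "(\<integral>z. - ln (pkernel (radius k) (fst z) (snd z)) \<partial>(arcsine_design \<Otimes>\<^sub>M arcsine_design)) \<le> 0"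
    by simp
qed

text \<open>A nonzero polynomial has finitely many roots, so it cannot vanish almost everywhere on
  (-1,1).\<close>

lemma arcsine_polynomial_definite:
  fixes c :: "nat \<Rightarrow> real"
  assumes "(\<integral>x. (\<Sum>i<m. c i * x ^ i)\<^sup>2 \<partial>arcsine_design) = 0" and "i < m"
  shows "c i = 0"
proof (rule ccontr)
  assume "c i \<noteq> 0"
  let ?g = "\<lambda>x. \<Sum>i<m. c i * x ^ i"
  have "integrable arcsine_design (\<lambda>x. (?g x)\<^sup>2)"
    by (intro arcsine.integrable_cont continuous_intros)
  from integral_nonneg_eq_0_iff_AE[OF this] assms(1)
  have "AE x in arcsine_design. ?g x = 0" by simp
  then have "AE x in lborel. x \<in> {-1<..<1} \<longrightarrow> ?g x = 0"
    by (subst (asm) AE_arcsine_iff) auto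
  moreover have "AE x in lborel. ?g x \<noteq> 0"
  proof -
    obtain k where k: "m = Suc k" using assms(2) by (cases m) auto
    have "finite {x. ?g x = 0}"
      using polyfun_finite_roots[of c k] \<open>c i \<noteq> 0\<close> assms(2) by (auto simp: k lessThan_Suc_atMost less_Suc_eq_le)
    from AE_not_in[OF finite_imp_null_set_lborel[OF this]] show ?thesis by simp
  qed
  ultimately have "AE x in lborel. x \<notin> {-1<..<1::real}" by eventually_elim auto
  then have "emeasure lborel {-1<..<1::real} = 0"
    by (subst (asm) AE_iff_measurable[OF _ refl]) (auto simp: greaterThanLessThan_def greaterThan_def lessThan_def Int_def)
  then show False by simp
qed

subsection \<open>The matrices of a design\<close>

text \<open>Finite integrals of both parts force \<open>g\<close> to be finite almost everywhere, so
  \<open>real_of_ereal\<close> changes neither part up to a null set and the Bochner integral can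
  take over.\<close>

lemma ereal_integrableD:
  assumes "ereal_integrable M g"
  shows "AE x in M. \<bar>g x\<bar> \<noteq> \<infinity>"
    and "integrable M (\<lambda>x. real_of_ereal (g x))"
    and "ereal_integral M g = (\<integral>x. real_of_ereal (g x) \<partial>M)"
proof -
  have [measurable]: "g \<in> borel_measurable M"
    and fin: "(\<integral>\<^sup>+x. e2ennreal (g x) \<partial>M) < \<infinity>" "(\<integral>\<^sup>+x. e2ennreal (- g x) \<partial>M) < \<infinity>"
    using assms by (auto simp: ereal_integrable_def)
  have "AE x in M. e2ennreal (g x) \<noteq> \<infinity>" "AE x in M. e2ennreal (- g x) \<noteq> \<infinity>"
    using fin by (intro nn_integral_PInf_AE; simp add: less_top)+
  then show AE: "AE x in M. \<bar>g x\<bar> \<noteq> \<infinity>"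
  proof eventually_elim
    case (elim x)
    then show ?case by (cases "g x") auto
  qed
  have "AE x in M. e2ennreal (g x) = ennreal (real_of_ereal (g x))"
    using AE
  proof eventually_elim
    case (elim x)
    then show ?case by (cases "g x") auto
  qed
  then have pos: "(\<integral>\<^sup>+x. e2ennreal (g x) \<partial>M) = (\<integral>\<^sup>+x. ennreal (real_of_ereal (g x)) \<partial>M)"
    by (rule nn_integral_cong_AE)
  have "AE x in M. e2ennreal (- g x) = ennreal (- real_of_ereal (g x))"
    using AE
  proof eventually_elim
    case (elim x)
    then show ?case by (cases "g x") auto
  qed
  then have neg: "(\<integral>\<^sup>+x. e2ennreal (- g x) \<partial>M) = (\<integral>\<^sup>+x. ennreal (- real_of_ereal (g x)) \<partial>M)"
    by (rule nn_integral_cong_AE)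
  show int: "integrable M (\<lambda>x. real_of_ereal (g x))"
    using fin unfolding real_integrable_def pos neg by auto
  show "ereal_integral M g = (\<integral>x. real_of_ereal (g x) \<partial>M)"
    unfolding ereal_integral_def pos neg real_lebesgue_integral_def[OF int] ..
qed

lemma ereal_integrableI:
  assumes [measurable]: "g \<in> borel_measurable M" and AE: "AE x in M. g x = ereal (h x)" and int: "integrable M h"
  shows "ereal_integrable M g"
proof -
  have "(\<integral>\<^sup>+x. e2ennreal (g x) \<partial>M) = (\<integral>\<^sup>+x. ennreal (h x) \<partial>M)"
    using AE by (intro nn_integral_cong_AE) (auto elim!: eventually_mono)
  moreover have "(\<integral>\<^sup>+x. e2ennreal (- g x) \<partial>M) = (\<integral>\<^sup>+x. ennreal (- h x) \<partial>M)"
    using AE by (intro nn_integral_cong_AE) (auto elim!: eventually_mono)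
  ultimately show ?thesis
    using int by (auto simp: ereal_integrable_def real_integrable_def less_top)
qed

lemma B_integrand_log_kernel:
  assumes "i < m" "j < m"
  shows "fst z \<noteq> snd z \<Longrightarrow> B_integrand (poly_regressors m) (log_kernel \<gamma> \<beta>) i j z =
    ereal ((\<gamma> - \<beta> * ln ((fst z - snd z)\<^sup>2)) * (fst z ^ i * snd z ^ j))"
  using assms by (cases z) (simp add: B_integrand_def log_kernel_def poly_regressors_def)

context design_measure
begin

lemma measurable_B_integrand:
  assumes ij: "i < m" "j < m"
  shows "B_integrand (poly_regressors m) (log_kernel \<gamma> \<beta>) i j \<in> borel_measurable (\<xi> \<Otimes>\<^sub>M \<xi>)"
proof -
  have "B_integrand (poly_regressors m) (log_kernel \<gamma> \<beta>) i j =
    (\<lambda>z. (if fst z = snd z then \<infinity> else ereal (\<gamma> - \<beta> * ln ((fst z - snd z)\<^sup>2))) * ereal (fst z ^ i * snd z ^ j))"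
    using ij by (auto simp: B_integrand_def log_kernel_def poly_regressors_def fun_eq_iff)
  then show ?thesis by simp
qed

text \<open>Monomials are bounded by 1 on [-1,1], so the kernel itself is a majorant.\<close>

lemma integrable_log_kernel_power:
  assumes "integrable (\<xi> \<Otimes>\<^sub>M \<xi>) (\<lambda>z. ln ((fst z - snd z)\<^sup>2))"
  shows "integrable (\<xi> \<Otimes>\<^sub>M \<xi>) (\<lambda>z. (\<gamma> - \<beta> * ln ((fst z - snd z)\<^sup>2)) * (fst z ^ i * snd z ^ j))"
proof (rule Bochner_Integration.integrable_bound)
  show "integrable (\<xi> \<Otimes>\<^sub>M \<xi>) (\<lambda>z. \<gamma> - \<beta> * ln ((fst z - snd z)\<^sup>2))"
    by (intro Bochner_Integration.integrable_diff integrable_mult_right assms) simp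
  show "AE z in \<xi> \<Otimes>\<^sub>M \<xi>. norm ((\<gamma> - \<beta> * ln ((fst z - snd z)\<^sup>2)) * (fst z ^ i * snd z ^ j))
      \<le> norm (\<gamma> - \<beta> * ln ((fst z - snd z)\<^sup>2))"
  proof (rule AE_I2)
    fix z assume "z \<in> space (\<xi> \<Otimes>\<^sub>M \<xi>)"
    then have "\<bar>fst z\<bar> \<le> 1" "\<bar>snd z\<bar> \<le> 1" using in_space[of z] by auto
    then have "\<bar>fst z\<bar> ^ i * \<bar>snd z\<bar> ^ j \<le> 1" by (intro mult_le_one power_le_one) auto
    then show "norm ((\<gamma> - \<beta> * ln ((fst z - snd z)\<^sup>2)) * (fst z ^ i * snd z ^ j))
      \<le> norm (\<gamma> - \<beta> * ln ((fst z - snd z)\<^sup>2))"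
      by (simp add: abs_mult power_abs mult_left_le)
  qed
qed measurable

text \<open>The entry (0, 0) is the integral of the kernel alone, as the first regressor is 1. Its
  finiteness makes the diagonal, where the kernel is infinite, a null set. The other entries only
  multiply the kernel by bounded monomials.\<close>

lemma B_well_defined_iff:
  assumes m: "1 \<le> m" and "0 < \<beta>"
  shows "B_well_defined m (poly_regressors m) (log_kernel \<gamma> \<beta>) \<xi> \<longleftrightarrow>
    (AE z in \<xi> \<Otimes>\<^sub>M \<xi>. fst z \<noteq> snd z) \<and> integrable (\<xi> \<Otimes>\<^sub>M \<xi>) (\<lambda>z. ln ((fst z - snd z)\<^sup>2))"
proof
  assume "B_well_defined m (poly_regressors m) (log_kernel \<gamma> \<beta>) \<xi>"
  then have *: "ereal_integrable (\<xi> \<Otimes>\<^sub>M \<xi>) (B_integrand (poly_regressors m) (log_kernel \<gamma> \<beta>) 0 0)" (is "ereal_integrable _ ?g")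
    using m by (auto simp: B_well_defined_def)
  have "AE z in \<xi> \<Otimes>\<^sub>M \<xi>. fst z \<noteq> snd z"
    using ereal_integrableD(1)[OF *]
  proof eventually_elim
    case (elim z)
    then show ?case
      using m by (cases z) (auto simp: B_integrand_def log_kernel_def poly_regressors_def)
  qed
  \<comment> \<open>The kernel solved for its logarithm, which is possible as \<beta> is
    positive.\<close>
  moreover have "integrable (\<xi> \<Otimes>\<^sub>M \<xi>) (\<lambda>z. (\<gamma> - real_of_ereal (?g z)) / \<beta>)"
    by (intro integrable_divide Bochner_Integration.integrable_diff ereal_integrableD(2)[OF *]) simp
  moreover have "AE z in \<xi> \<Otimes>\<^sub>M \<xi>. (\<gamma> - real_of_ereal (?g z)) / \<beta> = ln ((fst z - snd z)\<^sup>2)"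
    using \<open>AE z in \<xi> \<Otimes>\<^sub>M \<xi>. fst z \<noteq> snd z\<close>
    by eventually_elim (use assms in \<open>simp add: B_integrand_log_kernel\<close>)
  moreover have "(\<lambda>z. (\<gamma> - real_of_ereal (?g z)) / \<beta>) \<in> borel_measurable (\<xi> \<Otimes>\<^sub>M \<xi>)"
    using measurable_B_integrand[of 0 m 0 \<gamma> \<beta>] m by simp
  ultimately show "(AE z in \<xi> \<Otimes>\<^sub>M \<xi>. fst z \<noteq> snd z) \<and> integrable (\<xi> \<Otimes>\<^sub>M \<xi>) (\<lambda>z. ln ((fst z - snd z)\<^sup>2))"
    using integrable_cong_AE[of "\<lambda>z. (\<gamma> - real_of_ereal (?g z)) / \<beta>" "\<xi> \<Otimes>\<^sub>M \<xi>" "\<lambda>z. ln ((fst z - snd z)\<^sup>2)"] by auto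
next
  assume *: "(AE z in \<xi> \<Otimes>\<^sub>M \<xi>. fst z \<noteq> snd z) \<and> integrable (\<xi> \<Otimes>\<^sub>M \<xi>) (\<lambda>z. ln ((fst z - snd z)\<^sup>2))"
  show "B_well_defined m (poly_regressors m) (log_kernel \<gamma> \<beta>) \<xi>"
    unfolding B_well_defined_def
  proof (intro allI impI)
    fix i j assume ij: "i < m" "j < m"
    show "ereal_integrable (\<xi> \<Otimes>\<^sub>M \<xi>) (B_integrand (poly_regressors m) (log_kernel \<gamma> \<beta>) i j)"
    proof (rule ereal_integrableI)
      show "integrable (\<xi> \<Otimes>\<^sub>M \<xi>) (\<lambda>z. (\<gamma> - \<beta> * ln ((fst z - snd z)\<^sup>2)) * (fst z ^ i * snd z ^ j))"
        using * by (intro integrable_log_kernel_power) auto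
      show "AE z in \<xi> \<Otimes>\<^sub>M \<xi>. B_integrand (poly_regressors m) (log_kernel \<gamma> \<beta>) i j z =
          ereal ((\<gamma> - \<beta> * ln ((fst z - snd z)\<^sup>2)) * (fst z ^ i * snd z ^ j))"
        using *[THEN conjunct1] by eventually_elim (rule B_integrand_log_kernel[OF ij])
    qed (rule measurable_B_integrand[OF ij])
  qed
qed

end

section \<open>Inverse matrices and quadratic forms\<close>

lemma the_mat_inverse:
  fixes A :: "'a :: field mat"
  assumes A: "A \<in> carrier_mat n n" and inv: "invertible_mat A"
  shows "the (mat_inverse A) \<in> carrier_mat n n"
    and "A * the (mat_inverse A) = 1\<^sub>m n"
    and "the (mat_inverse A) * A = 1\<^sub>m n"
proof -
  obtain B where B: "A * B = 1\<^sub>m (dim_row A)" "B * A = 1\<^sub>m (dim_row B)"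
    using inv by (auto simp: invertible_mat_def inverts_mat_def)
  \<comment> \<open>\<open>invertible_mat\<close> does not fix the shape of the inverse; counting
    the columns of the two identities does.\<close>
  have "dim_col B = n" using arg_cong[OF B(1), of dim_col] A by simp
  moreover have "dim_row B = n" using arg_cong[OF B(2), of dim_col] A by simp
  ultimately have "B \<in> carrier_mat n n" by auto
  then have "A \<in> Units (ring_mat TYPE('a) n ())"
    using A B by (auto simp: Units_def ring_mat_def)
  then obtain C where "mat_inverse A = Some C"
    using mat_inverse(1)[OF A, where b = "()"] by (cases "mat_inverse A") auto
  then show "the (mat_inverse A) \<in> carrier_mat n n"
    "A * the (mat_inverse A) = 1\<^sub>m n" "the (mat_inverse A) * A = 1\<^sub>m n"
    using mat_inverse(2)[OF A] by auto
qed

text \<open>Transposing A C = 1 shows that the transpose of C is a left inverse of A, and a left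
  inverse equals the right inverse C.\<close>

lemma transpose_the_mat_inverse:
  fixes A :: "'a :: field mat"
  assumes A: "A \<in> carrier_mat n n" and inv: "invertible_mat A" and sym: "transpose_mat A = A"
  shows "transpose_mat (the (mat_inverse A)) = the (mat_inverse A)"
proof -
  let ?C = "the (mat_inverse A)"
  note C = the_mat_inverse[OF A inv]
  have Ct: "transpose_mat ?C \<in> carrier_mat n n" using C by simp
  have "transpose_mat (A * ?C) = transpose_mat ?C * transpose_mat A"
    using A C(1) by (rule transpose_mult)
  then have *: "transpose_mat ?C * A = 1\<^sub>m n" using C sym by simp
  have "transpose_mat ?C = transpose_mat ?C * (A * ?C)" using C Ct by simp
  also have "\<dots> = transpose_mat ?C * A * ?C" using assoc_mult_mat[OF Ct A C(1)] by simp
  also have "\<dots> = ?C" using * C by simp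
  finally show ?thesis .
qed

lemma quadratic_form:
  fixes A :: "'a :: comm_semiring_0 mat"
  assumes "A \<in> carrier_mat m m" "p \<in> carrier_vec m"
  shows "scalar_prod p (mult_mat_vec A p) = (\<Sum>i<m. \<Sum>j<m. vec_index p i * vec_index p j * A $$ (i, j))"
  using assms
  by (auto simp: scalar_prod_def mult_mat_vec_def sum_distrib_left lessThan_atLeast0 mult_ac
      intro!: sum.cong)

section \<open>Polynomials given by coefficient vectors, and their moments\<close>

definition poly_of_vec :: "real Matrix.vec \<Rightarrow> real \<Rightarrow> real" where
  "poly_of_vec p x = (\<Sum>i<dim_vec p. vec_index p i * x ^ i)"

lemma continuous_on_poly_of_vec: "continuous_on S (poly_of_vec p)"
  unfolding poly_of_vec_def by (intro continuous_intros)

lemma measurable_poly_of_vec [measurable]: "poly_of_vec p \<in> borel_measurable borel"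
  by (intro borel_measurable_continuous_onI continuous_on_poly_of_vec)

lemma poly_of_vec_bounded:
  assumes "x \<in> {-1..1}"
  shows "\<bar>poly_of_vec p x\<bar> \<le> (\<Sum>i<dim_vec p. \<bar>vec_index p i\<bar>)"
proof -
  have "\<bar>poly_of_vec p x\<bar> \<le> (\<Sum>i<dim_vec p. \<bar>vec_index p i * x ^ i\<bar>)"
    unfolding poly_of_vec_def by (rule sum_abs)
  also have "\<dots> \<le> (\<Sum>i<dim_vec p. \<bar>vec_index p i\<bar>)"
    using assms by (intro sum_mono) (auto simp: abs_mult power_abs intro!: mult_left_le power_le_one)
  finally show ?thesis .
qed

context design_measure
begin

lemma info_mat_carrier: "info_mat m f \<xi> \<in> carrier_mat m m"
  by (simp add: info_mat_def)

lemma transpose_info_mat: "transpose_mat (info_mat m f \<xi>) = info_mat m f \<xi>"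
  by (auto simp: info_mat_def mult.commute)

text \<open>Turns the equation M p = c into a statement on power moments: the j-th moment of the
  polynomial of p under \<xi> is the j-th entry of c.\<close>

lemma info_mat_mult_vec:
  assumes p: "p \<in> carrier_vec m" and "j < m"
  shows "vec_index (mult_mat_vec (info_mat m (poly_regressors m) \<xi>) p) j = (\<integral>x. x ^ j * poly_of_vec p x \<partial>\<xi>)"
proof -
  have int: "integrable \<xi> (\<lambda>x. x ^ j * x ^ i)" for i by (intro integrable_cont continuous_intros)
  have "(\<integral>x. x ^ j * poly_of_vec p x \<partial>\<xi>) = (\<integral>x. (\<Sum>i<m. vec_index p i * (x ^ j * x ^ i)) \<partial>\<xi>)"
    using p by (intro Bochner_Integration.integral_cong refl)
      (auto simp: poly_of_vec_def sum_distrib_left mult_ac)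
  also have "\<dots> = (\<Sum>i<m. vec_index p i * (\<integral>x. x ^ j * x ^ i \<partial>\<xi>))"
    using int by (subst Bochner_Integration.integral_sum) auto
  also have "\<dots> = vec_index (mult_mat_vec (info_mat m (poly_regressors m) \<xi>) p) j"
    using assms by (auto simp: mult_mat_vec_def scalar_prod_def info_mat_def poly_regressors_def
        lessThan_atLeast0 mult.commute intro!: sum.cong)
  finally show ?thesis ..
qed

text \<open>The form is a squared L2 norm, so invertibility of M reduces to definiteness on
  polynomials.\<close>

lemma info_mat_quadratic_form:
  assumes p: "p \<in> carrier_vec m"
  shows "scalar_prod p (mult_mat_vec (info_mat m (poly_regressors m) \<xi>) p) = (\<integral>x. (poly_of_vec p x)\<^sup>2 \<partial>\<xi>)"
proof -
  have int: "integrable \<xi> (\<lambda>x. x ^ j * poly_of_vec p x)" for j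
    by (intro integrable_cont continuous_intros continuous_on_poly_of_vec)
  have "(\<integral>x. (poly_of_vec p x)\<^sup>2 \<partial>\<xi>) = (\<integral>x. (\<Sum>j<m. vec_index p j * (x ^ j * poly_of_vec p x)) \<partial>\<xi>)"
    using p by (intro Bochner_Integration.integral_cong refl)
      (auto simp: power2_eq_square poly_of_vec_def sum_distrib_right mult_ac)
  also have "\<dots> = (\<Sum>j<m. vec_index p j * (\<integral>x. x ^ j * poly_of_vec p x \<partial>\<xi>))"
    using int by (subst Bochner_Integration.integral_sum) auto
  also have "\<dots> = (\<Sum>j<m. vec_index p j * vec_index (mult_mat_vec (info_mat m (poly_regressors m) \<xi>) p) j)"
    by (intro sum.cong refl) (simp add: info_mat_mult_vec[OF p])
  also have "\<dots> = scalar_prod p (mult_mat_vec (info_mat m (poly_regressors m) \<xi>) p)"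
    by (simp add: scalar_prod_def lessThan_atLeast0 info_mat_def)
  finally show ?thesis ..
qed

text \<open>The right side involves the design only through c. Two designs whose polynomials satisfy
  M p = c with the same c thus share all Chebyshev moments with n < m.\<close>

lemma cheb_moment:
  assumes p: "p \<in> carrier_vec m" and c: "mult_mat_vec (info_mat m (poly_regressors m) \<xi>) p = c"
    and a: "\<And>x. cheb n x = (\<Sum>j\<le>n. a j * x ^ j)" and n: "n < m"
  shows "(\<integral>x. cheb n x * poly_of_vec p x \<partial>\<xi>) = (\<Sum>j\<le>n. a j * vec_index c j)"
proof -
  have int: "integrable \<xi> (\<lambda>x. x ^ j * poly_of_vec p x)" for j
    by (intro integrable_cont continuous_intros continuous_on_poly_of_vec)
  have "(\<integral>x. cheb n x * poly_of_vec p x \<partial>\<xi>) = (\<integral>x. (\<Sum>j\<le>n. a j * (x ^ j * poly_of_vec p x)) \<partial>\<xi>)"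
    unfolding a sum_distrib_right mult.assoc ..
  also have "\<dots> = (\<Sum>j\<le>n. a j * (\<integral>x. x ^ j * poly_of_vec p x \<partial>\<xi>))"
    using int by (subst Bochner_Integration.integral_sum) auto
  also have "\<dots> = (\<Sum>j\<le>n. a j * vec_index c j)"
    using n by (intro sum.cong refl) (simp add: info_mat_mult_vec[OF p] flip: c)
  finally show ?thesis .
qed

end

text \<open>The two conditions to which \<open>B_well_defined_iff\<close> reduces the existence of
  B, for m \<ge> 1 and \<beta> > 0. They mention neither m nor the constants of the kernel.\<close>

locale log_design = design_measure +
  assumes off_diagonal: "AE z in \<xi> \<Otimes>\<^sub>M \<xi>. fst z \<noteq> snd z"
    and ln_integrable: "integrable (\<xi> \<Otimes>\<^sub>M \<xi>) (\<lambda>z. ln ((fst z - snd z)\<^sup>2))"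
begin

lemma B_mat_index:
  assumes ij: "i < m" "j < m" and "0 < \<beta>"
  shows "B_mat m (poly_regressors m) (log_kernel \<gamma> \<beta>) \<xi> $$ (i, j) =
    (\<integral>z. (\<gamma> - \<beta> * ln ((fst z - snd z)\<^sup>2)) * (fst z ^ i * snd z ^ j) \<partial>(\<xi> \<Otimes>\<^sub>M \<xi>))"
proof -
  let ?g = "B_integrand (poly_regressors m) (log_kernel \<gamma> \<beta>) i j"
  have "B_well_defined m (poly_regressors m) (log_kernel \<gamma> \<beta>) \<xi>"
    using assms B_well_defined_iff[of m \<beta> \<gamma>] off_diagonal ln_integrable by auto
  then have *: "ereal_integrable (\<xi> \<Otimes>\<^sub>M \<xi>) ?g" using ij by (auto simp: B_well_defined_def)
  have [measurable]: "?g \<in> borel_measurable (\<xi> \<Otimes>\<^sub>M \<xi>)" using ij by (rule measurable_B_integrand)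
  have "(\<integral>z. real_of_ereal (?g z) \<partial>(\<xi> \<Otimes>\<^sub>M \<xi>)) =
    (\<integral>z. (\<gamma> - \<beta> * ln ((fst z - snd z)\<^sup>2)) * (fst z ^ i * snd z ^ j) \<partial>(\<xi> \<Otimes>\<^sub>M \<xi>))"
  proof (rule integral_cong_AE)
    show "AE z in \<xi> \<Otimes>\<^sub>M \<xi>. real_of_ereal (?g z) = (\<gamma> - \<beta> * ln ((fst z - snd z)\<^sup>2)) * (fst z ^ i * snd z ^ j)"
      using off_diagonal by eventually_elim (simp add: B_integrand_log_kernel[OF ij])
  qed measurable
  then show ?thesis using ij ereal_integrableD(3)[OF *] by (simp add: B_mat_def)
qed

lemma B_mat_carrier: "B_mat m f K \<xi> \<in> carrier_mat m m"
  by (simp add: B_mat_def)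

text \<open>The kernel is symmetric and both variables have the same distribution, so they may be
  swapped in the integral.\<close>

lemma transpose_B_mat:
  assumes "0 < \<beta>"
  shows "transpose_mat (B_mat m (poly_regressors m) (log_kernel \<gamma> \<beta>) \<xi>) = B_mat m (poly_regressors m) (log_kernel \<gamma> \<beta>) \<xi>"
    (is "transpose_mat ?B = ?B")
proof (rule eq_matI)
  fix i j assume "i < dim_row ?B" "j < dim_col ?B"
  then have ij: "i < m" "j < m" by (auto simp: B_mat_def)
  have "(\<integral>z. (\<gamma> - \<beta> * ln ((fst z - snd z)\<^sup>2)) * (fst z ^ i * snd z ^ j) \<partial>(\<xi> \<Otimes>\<^sub>M \<xi>)) =
    (\<integral>z. (\<gamma> - \<beta> * ln ((fst z - snd z)\<^sup>2)) * (fst z ^ j * snd z ^ i) \<partial>(\<xi> \<Otimes>\<^sub>M \<xi>))"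
    by (subst product.integral_product_swap[symmetric])
      (auto simp: case_prod_beta' power2_commute mult.commute)
  then show "transpose_mat ?B $$ (i, j) = ?B $$ (i, j)"
    using ij \<open>0 < \<beta>\<close> carrier_matD[OF B_mat_carrier] by (simp add: B_mat_index)
qed (simp_all add: B_mat_def)

text \<open>Splits off the contribution of the constant polynomial T_0, the squared mean of the
  polynomial; the remaining energy is the one expanded in T_n with n \<ge> 1.\<close>

lemma B_mat_quadratic_form:
  assumes p: "p \<in> carrier_vec m" and "0 < \<beta>"
  shows "scalar_prod p (mult_mat_vec (B_mat m (poly_regressors m) (log_kernel \<gamma> \<beta>) \<xi>) p) =
    (\<gamma> + \<beta> * ln 4) * (\<integral>x. poly_of_vec p x \<partial>\<xi>)\<^sup>2 +
    \<beta> * (\<integral>z. - ln (4 * (fst z - snd z)\<^sup>2) * (poly_of_vec p (fst z) * poly_of_vec p (snd z)) \<partial>(\<xi> \<Otimes>\<^sub>M \<xi>))"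
proof -
  let ?g = "poly_of_vec p" and ?k = "\<lambda>z. \<gamma> - \<beta> * ln ((fst z - snd z)\<^sup>2)"
  note [measurable] = measurable_fst_comp[OF measurable_poly_of_vec] measurable_snd_comp[OF measurable_poly_of_vec]
  let ?C = "\<Sum>i<dim_vec p. \<bar>vec_index p i\<bar>"
  have C0: "0 \<le> ?C" by (intro sum_nonneg) auto
  have gg_int: "integrable (\<xi> \<Otimes>\<^sub>M \<xi>) (\<lambda>z. ?g (fst z) * ?g (snd z))"
  proof (rule product.integrable_const_bound[of _ "?C * ?C"])
    show "AE z in \<xi> \<Otimes>\<^sub>M \<xi>. norm (?g (fst z) * ?g (snd z)) \<le> ?C * ?C"
      using in_space C0 by (intro AE_I2) (auto simp: abs_mult intro!: mult_mono poly_of_vec_bounded)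
  qed measurable
  have ln_int: "integrable (\<xi> \<Otimes>\<^sub>M \<xi>) (\<lambda>z. - ln (4 * (fst z - snd z)\<^sup>2) * (?g (fst z) * ?g (snd z)))"
    by (rule integrable_ln_energy[OF off_diagonal ln_integrable measurable_poly_of_vec poly_of_vec_bounded])
  have int: "integrable (\<xi> \<Otimes>\<^sub>M \<xi>) (\<lambda>z. ?k z * (fst z ^ i * snd z ^ j))" for i j
    by (rule integrable_log_kernel_power[OF ln_integrable])
  have "scalar_prod p (mult_mat_vec (B_mat m (poly_regressors m) (log_kernel \<gamma> \<beta>) \<xi>) p) =
      (\<Sum>i<m. \<Sum>j<m. vec_index p i * vec_index p j * (\<integral>z. ?k z * (fst z ^ i * snd z ^ j) \<partial>(\<xi> \<Otimes>\<^sub>M \<xi>)))"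
    unfolding quadratic_form[OF B_mat_carrier p]
    using \<open>0 < \<beta>\<close> by (intro sum.cong refl) (simp add: B_mat_index)
  also have "\<dots> = (\<integral>z. (\<Sum>i<m. \<Sum>j<m. vec_index p i * vec_index p j * (?k z * (fst z ^ i * snd z ^ j))) \<partial>(\<xi> \<Otimes>\<^sub>M \<xi>))"
    using int by (simp add: Bochner_Integration.integral_sum)
  also have "\<dots> = (\<integral>z. ?k z * (?g (fst z) * ?g (snd z)) \<partial>(\<xi> \<Otimes>\<^sub>M \<xi>))"
  proof (intro Bochner_Integration.integral_cong refl)
    fix z :: "real \<times> real"
    have "?k z * (?g (fst z) * ?g (snd z)) = (\<Sum>i<m. \<Sum>j<m. ?k z *
        (vec_index p i * fst z ^ i * (vec_index p j * snd z ^ j)))"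
      unfolding poly_of_vec_def carrier_vecD[OF p] sum_product by (simp only: sum_distrib_left)
    then show "(\<Sum>i<m. \<Sum>j<m. vec_index p i * vec_index p j * (?k z * (fst z ^ i * snd z ^ j))) =
        ?k z * (?g (fst z) * ?g (snd z))"
      by (simp add: mult_ac)
  qed
  \<comment> \<open>The series belongs to 4 (u - v)^2, so \<beta> ln 4 is added to the constant and
    subtracted again. The identity holds off the diagonal only: \<open>ln 0 = 0\<close> breaks it at
    u = v.\<close>
  also have "\<dots> = (\<integral>z. (\<gamma> + \<beta> * ln 4) * (?g (fst z) * ?g (snd z)) +
      \<beta> * (- ln (4 * (fst z - snd z)\<^sup>2) * (?g (fst z) * ?g (snd z))) \<partial>(\<xi> \<Otimes>\<^sub>M \<xi>))"
  proof (rule integral_cong_AE)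
    show "AE z in \<xi> \<Otimes>\<^sub>M \<xi>. ?k z * (?g (fst z) * ?g (snd z)) = (\<gamma> + \<beta> * ln 4) * (?g (fst z) * ?g (snd z)) +
      \<beta> * (- ln (4 * (fst z - snd z)\<^sup>2) * (?g (fst z) * ?g (snd z)))"
      using off_diagonal by eventually_elim (simp add: ln_mult algebra_simps)
  qed measurable
  also have "\<dots> = (\<gamma> + \<beta> * ln 4) * (\<integral>z. ?g (fst z) * ?g (snd z) \<partial>(\<xi> \<Otimes>\<^sub>M \<xi>)) +
      \<beta> * (\<integral>z. - ln (4 * (fst z - snd z)\<^sup>2) * (?g (fst z) * ?g (snd z)) \<partial>(\<xi> \<Otimes>\<^sub>M \<xi>))"
    by (subst Bochner_Integration.integral_add[OF integrable_mult_right[OF gg_int] integrable_mult_right[OF ln_int]])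
      (simp only: integral_mult_right_zero)
  also have "(\<integral>z. ?g (fst z) * ?g (snd z) \<partial>(\<xi> \<Otimes>\<^sub>M \<xi>)) = (\<integral>x. ?g x \<partial>\<xi>)\<^sup>2"
    by (simp add: product_integral[OF gg_int] power2_eq_square)
  finally show ?thesis .
qed

text \<open>With p = M^(-1) c and M^(-1) symmetric, the form of D at c is the form of B at p. The
  vector p is described by M p = c because this is the form that yields its moments.\<close>

lemma D_mat_properties:
  fixes m :: nat and \<beta> \<gamma> :: real
  assumes inv: "invertible_mat (info_mat m (poly_regressors m) \<xi>)" and "0 < \<beta>"
  defines "D \<equiv> D_mat m (poly_regressors m) (log_kernel \<gamma> \<beta>) \<xi>"
  shows "D \<in> carrier_mat m m" and "transpose_mat D = D"
    and "\<And>c. c \<in> carrier_vec m \<Longrightarrow> \<exists>p\<in>carrier_vec m. mult_mat_vec (info_mat m (poly_regressors m) \<xi>) p = c \<and>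
      scalar_prod c (mult_mat_vec D c) =
        scalar_prod p (mult_mat_vec (B_mat m (poly_regressors m) (log_kernel \<gamma> \<beta>) \<xi>) p)"
proof -
  let ?M = "info_mat m (poly_regressors m) \<xi>" and ?B = "B_mat m (poly_regressors m) (log_kernel \<gamma> \<beta>) \<xi>"
  let ?C = "the (mat_inverse ?M)"
  note M = info_mat_carrier[of m "poly_regressors m"]
  note C = the_mat_inverse[OF M inv]
  note Ct = transpose_the_mat_inverse[OF M inv transpose_info_mat]
  note B = B_mat_carrier[of m "poly_regressors m" "log_kernel \<gamma> \<beta>"]
  have CB: "?C * ?B \<in> carrier_mat m m" using C(1) B by simp
  show "D \<in> carrier_mat m m" using CB C(1) by (simp add: D_def D_mat_def)
  have "transpose_mat D = ?C * (?B * ?C)"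
    unfolding D_def D_mat_def transpose_mult[OF CB C(1)] transpose_mult[OF C(1) B] Ct transpose_B_mat[OF \<open>0 < \<beta>\<close>] ..
  then show "transpose_mat D = D"
    using assoc_mult_mat[OF C(1) B C(1)] by (simp add: D_def D_mat_def)
  fix c :: "real Matrix.vec" assume c: "c \<in> carrier_vec m"
  define p where "p = mult_mat_vec ?C c"
  have p: "p \<in> carrier_vec m" using C(1) c by (simp add: p_def)
  have "mult_mat_vec ?M p = c"
    unfolding p_def assoc_mult_mat_vec[OF M C(1) c, symmetric] C(2) using c by simp
  moreover have "mult_mat_vec D c = mult_mat_vec ?C (mult_mat_vec ?B p)"
    unfolding D_def D_mat_def p_def assoc_mult_mat_vec[OF CB C(1) c]
    by (rule assoc_mult_mat_vec[OF C(1) B]) (use C(1) c in simp)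
  then have "scalar_prod c (mult_mat_vec D c) = scalar_prod p (mult_mat_vec ?B p)"
    using transpose_vec_mult_scalar[OF C(1) c, of "mult_mat_vec ?B p"] B p C(1) Ct
      comm_scalar_prod[OF p, of "mult_mat_vec ?B p"]
      comm_scalar_prod[OF c, of "mult_mat_vec ?C (mult_mat_vec ?B p)"]
    by (simp flip: p_def)
  ultimately show "\<exists>p\<in>carrier_vec m. mult_mat_vec ?M p = c \<and> scalar_prod c (mult_mat_vec D c) = scalar_prod p (mult_mat_vec ?B p)"
    using p by blast
qed

end

section \<open>Admissibility and optimality of the arcsine design\<close>

interpretation arcsine: log_design arcsine_design
  by unfold_locales (rule arcsine_off_diagonal arcsine_ln_integrable)+

text \<open>A kernel vector of M is the coefficient vector of a polynomial with zero L2 norm, hence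
  it is 0.\<close>

lemma arcsine_info_mat_invertible:
  "invertible_mat (info_mat m (poly_regressors m) arcsine_design)"
proof -
  let ?M = "info_mat m (poly_regressors m) arcsine_design"
  note M = arcsine.info_mat_carrier[of m "poly_regressors m"]
  have "Determinant.det ?M \<noteq> 0"
  proof
    assume "Determinant.det ?M = 0"
    then obtain v where v: "v \<in> carrier_vec m" "v \<noteq> 0\<^sub>v m" "mult_mat_vec ?M v = 0\<^sub>v m"
      using det_0_iff_vec_prod_zero[OF M] by auto
    have "(\<integral>x. (poly_of_vec v x)\<^sup>2 \<partial>arcsine_design) = 0"
      using arcsine.info_mat_quadratic_form[OF v(1)] v by simp
    then have "vec_index v i = 0" if "i < m" for i
      using v(1) that arcsine_polynomial_definite[of "vec_index v" m i] by (simp add: poly_of_vec_def)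
    then have "v = 0\<^sub>v m" using v(1) by (intro eq_vecI) auto
    then show False using v(2) by contradiction
  qed
  from det_non_zero_imp_unit[OF M this, of "()"]
  obtain B where "B \<in> carrier_mat m m" "B * ?M = 1\<^sub>m m" "?M * B = 1\<^sub>m m"
    by (auto simp: Units_def ring_mat_def)
  then show ?thesis using M by (auto simp: invertible_mat_def inverts_mat_def square_mat.simps)
qed

theorem theorem4p5:
  fixes m :: nat and \<beta> \<gamma> :: real
  assumes "m \<ge> 1" and "\<beta> > 0" and "\<gamma> \<ge> 0"
  shows "universally_optimal m (poly_regressors m) (log_kernel \<gamma> \<beta>) arcsine_design"
proof -
  let ?f = "poly_regressors m" and ?K = "log_kernel \<gamma> \<beta>"
  have admissible: "arcsine_design \<in> admissible_designs m ?f ?K"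
    using arcsine.B_well_defined_iff[OF assms(1,2)] arcsine.off_diagonal arcsine.ln_integrable
      arcsine_info_mat_invertible arcsine.sets_eq arcsine.prob_space_axioms
    by (auto simp: admissible_designs_def design_def)
  have "loewner_le m (D_mat m ?f ?K arcsine_design) (D_mat m ?f ?K \<eta>)"
    if \<eta>: "\<eta> \<in> admissible_designs m ?f ?K" for \<eta>
  proof -
    interpret Y: design_measure \<eta>
      using \<eta> by (auto simp: admissible_designs_def design_def design_measure_def design_measure_axioms_def)
    interpret Y: log_design \<eta>
      using \<eta> Y.B_well_defined_iff[OF assms(1,2)] by unfold_locales (auto simp: admissible_designs_def)
    have inv: "invertible_mat (info_mat m ?f \<eta>)" using \<eta> by (simp add: admissible_designs_def)
    let ?X = "D_mat m ?f ?K arcsine_design" and ?Y = "D_mat m ?f ?K \<eta>"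
    note X = arcsine.D_mat_properties[OF arcsine_info_mat_invertible \<open>\<beta> > 0\<close>, where m = m and \<gamma> = \<gamma>]
    note Y = Y.D_mat_properties[OF inv \<open>\<beta> > 0\<close>, where \<gamma> = \<gamma>]
    have "0 \<le> scalar_prod c (mult_mat_vec (?Y - ?X) c)" if c: "c \<in> carrier_vec m" for c
    proof -
      obtain p where p: "p \<in> carrier_vec m" "mult_mat_vec (info_mat m ?f arcsine_design) p = c"
        and p_form: "scalar_prod c (mult_mat_vec ?X c) = scalar_prod p (mult_mat_vec (B_mat m ?f ?K arcsine_design) p)"
        using X(3)[OF c] by blast
      obtain q where q: "q \<in> carrier_vec m" "mult_mat_vec (info_mat m ?f \<eta>) q = c"
        and q_form: "scalar_prod c (mult_mat_vec ?Y c) = scalar_prod q (mult_mat_vec (B_mat m ?f ?K \<eta>) q)"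
        using Y(3)[OF c] by blast
      \<comment> \<open>Both sides are computed from the same vector c, since p and q solve M p = c
        for their respective designs.\<close>
      have low: "(\<integral>x. cheb n x * poly_of_vec p x \<partial>arcsine_design) = (\<integral>x. cheb n x * poly_of_vec q x \<partial>\<eta>)"
        if "n < m" for n
      proof -
        obtain a where a: "\<And>x. cheb n x = (\<Sum>j\<le>n. a j * x ^ j)" using cheb_poly_expansion by blast
        show ?thesis
          using arcsine.cheb_moment[OF p a that] Y.cheb_moment[OF q a that] by simp
      qed
      \<comment> \<open>The polynomial of p has degree below m, and T_n with n \<ge> m is orthogonal
        to all such polynomials.\<close>
      have high: "(\<integral>x. cheb n x * poly_of_vec p x \<partial>arcsine_design) = 0" if "m \<le> n" for n
      proof -
        have int: "integrable arcsine_design (\<lambda>x. cheb n x * x ^ i)" for i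
          by (intro arcsine.integrable_cont continuous_intros continuous_on_cheb)
        have "(\<integral>x. cheb n x * poly_of_vec p x \<partial>arcsine_design) =
            (\<integral>x. (\<Sum>i<m. vec_index p i * (cheb n x * x ^ i)) \<partial>arcsine_design)"
          using p(1) by (intro Bochner_Integration.integral_cong refl)
            (auto simp: poly_of_vec_def sum_distrib_left mult_ac)
        also have "\<dots> = (\<Sum>i<m. vec_index p i * (\<integral>x. cheb n x * x ^ i \<partial>arcsine_design))"
          using int by (subst Bochner_Integration.integral_sum) auto
        also have "\<dots> = 0"
          using that by (intro sum.neutral) (simp add: arcsine_cheb_power_integral)
        finally show ?thesis .
      qed
      \<comment> \<open>The moment of T_0 = 1: the two quadratic forms have the same squared mean,
        so only their energies differ.\<close>
      have "(\<integral>x. poly_of_vec p x \<partial>arcsine_design) = (\<integral>x. poly_of_vec q x \<partial>\<eta>)"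
        using low[of 0] \<open>m \<ge> 1\<close> by simp
      moreover have "(\<integral>z. - ln (4 * (fst z - snd z)\<^sup>2) * (poly_of_vec p (fst z) * poly_of_vec p (snd z)) \<partial>(arcsine_design \<Otimes>\<^sub>M arcsine_design))
        \<le> (\<integral>z. - ln (4 * (fst z - snd z)\<^sup>2) * (poly_of_vec q (fst z) * poly_of_vec q (snd z)) \<partial>(\<eta> \<Otimes>\<^sub>M \<eta>))"
        by (rule ln_energy_le[OF arcsine.design_measure_axioms Y.design_measure_axioms
              arcsine.off_diagonal Y.off_diagonal arcsine.ln_integrable Y.ln_integrable
              measurable_poly_of_vec measurable_poly_of_vec poly_of_vec_bounded poly_of_vec_bounded low high])
      ultimately have "scalar_prod c (mult_mat_vec ?X c) \<le> scalar_prod c (mult_mat_vec ?Y c)"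
        unfolding p_form q_form arcsine.B_mat_quadratic_form[OF p(1) \<open>\<beta> > 0\<close>] Y.B_mat_quadratic_form[OF q(1) \<open>\<beta> > 0\<close>]
        using \<open>\<beta> > 0\<close> by (simp add: mult_left_mono)
      moreover have "scalar_prod c (mult_mat_vec (?Y - ?X) c) =
          scalar_prod c (mult_mat_vec ?Y c) - scalar_prod c (mult_mat_vec ?X c)"
        using X(1) Y(1) c by (simp add: minus_mult_distrib_mat_vec scalar_prod_minus_distrib[of _ m])
      ultimately show ?thesis by simp
    qed
    moreover have "transpose_mat (?Y - ?X) = ?Y - ?X"
      using transpose_minus[OF Y(1) X(1)] X(2) Y(2) by simp
    ultimately show ?thesis
      using X(1) Y(1) by (simp add: loewner_le_def psd_mat_def minus_carrier_mat)
  qed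
  then show ?thesis using admissible by (simp add: universally_optimal_def)
qed

end
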